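(* Let $\mathcal{A}$ be a plus-one generated arrangement of lines in $\mathbb{P}^2=\mathbb{P}^2(\mathbb{C})$ of exponents $(a,b)$ and level $d$, let $l\in\mathcal{A}$, and let $h=|l\cap\mathcal{A}|$ be the number of distinct intersection points of $\mathcal{A}$ on $l$. Then one of the following holds: $h<a$; $h=a$; $h=a+1$; $h=b$; $h=b+1$; $h=d+1$.
   Context: An arrangement $\mathcal{A}$ is a finite set of $n=|\mathcal{A}|$ distinct lines in $\mathbb{P}^2=\mathbb{P}^2(\mathbb{C})$, with defining polynomial $f_{\mathcal{A}}=\prod_{H\in\mathcal{A}}\alpha_H$, where $\alpha_H\in\mathbb{C}[x,y,z]$ is a linear form defining $H$. The vector bundle associated to $\mathcal{A}$ is the rank $2$ vector bundle $\mathcal{T}_{\mathcal{A}}=\ker\big(\nabla f_{\mathcal{A}}:\mathcal{O}_{\mathbb{P}^2}^3\to\mathcal{O}_{\mathbb{P}^2}(n-1)\big)$, where $\nabla f_{\mathcal{A}}=[\partial_x f_{\mathcal{A}}\ \partial_y f_{\mathcal{A}}\ \partial_z f_{\mathcal{A}}]$. $\mathcal{A}$ is plus-one generated of exponents $(a,b)$ and level $d$, where $a\le b\le d$, if there is an exact sequence $$0\to\mathcal{O}_{\mathbb{P}^2}(-1-d)\to\mathcal{O}_{\mathbb{P}^2}(-d)\oplus\mathcal{O}_{\mathbb{P}^2}(-b)\oplus\mathcal{O}_{\mathbb{P}^2}(-a)\to\mathcal{T}_{\mathcal{A}}\to0.$$ For $l\in\mathcal{A}$, $|l\cap\mathcal{A}|$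 is the number of distinct points of $l$ at which $l$ meets the other lines of $\mathcal{A}$. *)

theory Defs
  imports "HOL-Analysis.Analysis"
begin

text \<open>
  The complex projective plane is treated as a classical variety, with coherent sheaves given by
  their sections over Zariski open sets. A point is a one-dimensional subspace of \<open>complex ^ 3\<close>.
  Since the field is infinite, polynomials are identified with the functions they define.
\<close>

type_synonym point = "(complex ^ 3) set"

definition P2 :: "point set" where
  "P2 = {vec.span {v} | v. v \<noteq> 0}"

text \<open>The zero polynomial is homogeneous of every degree.\<close>

definition hom_poly :: "nat \<Rightarrow> (complex ^ 3 \<Rightarrow> complex) \<Rightarrow> bool" where
  "hom_poly m g \<longleftrightarrow>
     (\<exists>c. \<forall>v. g v = (\<Sum>i\<le>m. \<Sum>j\<le>m - i. c i j * (v $ 1) ^ i * (v $ 2) ^ j * (v $ 3) ^ (m - i - j)))"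

definition zariski_open :: "point set \<Rightarrow> bool" where
  "zariski_open U \<longleftrightarrow>
     (\<exists>G. (\<forall>g\<in>G. \<exists>m. hom_poly m g) \<and> U = {p \<in> P2. \<exists>g\<in>G. \<exists>v\<in>p. g v \<noteq> 0})"

definition cone :: "point set \<Rightarrow> (complex ^ 3) set" where
  "cone U = {v. v \<noteq> 0 \<and> vec.span {v} \<in> U}"


subsection \<open>Sheaves\<close>

text \<open>
  All sheaves involved are subsheaves of direct sums of line bundles \<open>\<O>(k)\<close>. A section over \<open>U\<close> of
  such a sum is a vector of functions in homogeneous coordinates, defined on the cone over \<open>U\<close>;
  it is extended by zero to all of \<open>complex ^ 3\<close> so that equality of sections is equality of
  functions. The module operations are pointwise.
\<close>

type_synonym 'r sect = "complex ^ 3 \<Rightarrow> complex ^ 'r"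
type_synonym 'r sheaf = "point set \<Rightarrow> 'r sect set"

definition restr :: "point set \<Rightarrow> 'r::finite sect \<Rightarrow> 'r sect" where
  "restr V s = (\<lambda>v. if v \<in> cone V then s v else 0)"

text \<open>Sections of \<open>\<O>(k)\<close>: locally quotients of homogeneous polynomials, of total degree \<open>k\<close>.\<close>

definition twist_sections :: "int \<Rightarrow> point set \<Rightarrow> (complex ^ 3 \<Rightarrow> complex) set" where
  "twist_sections k U =
     {s. (\<forall>v. v \<notin> cone U \<longrightarrow> s v = 0) \<and>
         (\<forall>p\<in>U. \<exists>V P Q i j. zariski_open V \<and> p \<in> V \<and> V \<subseteq> U \<and>
            hom_poly i P \<and> hom_poly j Q \<and> int i - int j = k \<and>
            (\<forall>v\<in>cone V. Q v \<noteq> 0 \<and> s v = P v / Q v))}"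

text \<open>The direct sum of the line bundles \<open>\<O>(k $ i)\<close>.\<close>

definition twist_sum :: "int ^ 'r \<Rightarrow> 'r::finite sheaf" where
  "twist_sum k U = {s. \<forall>i. (\<lambda>v. s v $ i) \<in> twist_sections (k $ i) U}"

definition sheaf_morphism ::
    "'r::finite sheaf \<Rightarrow> 'q::finite sheaf \<Rightarrow> (point set \<Rightarrow> 'r sect \<Rightarrow> 'q sect) \<Rightarrow> bool" where
  "sheaf_morphism F G \<phi> \<longleftrightarrow>
     (\<forall>U. zariski_open U \<longrightarrow>
        (\<forall>s\<in>F U. \<phi> U s \<in> G U) \<and>
        (\<forall>s\<in>F U. \<forall>t\<in>F U. \<phi> U (\<lambda>v. s v + t v) = (\<lambda>v. \<phi> U s v + \<phi> U t v)) \<and>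
        (\<forall>g\<in>twist_sections 0 U. \<forall>s\<in>F U. \<phi> U (\<lambda>v. g v *s s v) = (\<lambda>v. g v *s \<phi> U s v)) \<and>
        (\<forall>V. zariski_open V \<and> V \<subseteq> U \<longrightarrow> (\<forall>s\<in>F U. \<phi> V (restr V s) = restr V (\<phi> U s))))"

definition kernel_sheaf ::
    "'r::finite sheaf \<Rightarrow> (point set \<Rightarrow> 'r sect \<Rightarrow> 'q::finite sect) \<Rightarrow> 'r sheaf" where
  "kernel_sheaf F \<phi> U = {s \<in> F U. \<phi> U s = (\<lambda>_. 0)}"

text \<open>The image sheaf: sections of the target that locally lie in the image.\<close>

definition image_sheaf ::
    "'r::finite sheaf \<Rightarrow> 'q::finite sheaf \<Rightarrow> (point set \<Rightarrow> 'r sect \<Rightarrow> 'q sect) \<Rightarrow> 'q sheaf" where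
  "image_sheaf F G \<phi> U =
     {t \<in> G U. \<forall>p\<in>U. \<exists>V. zariski_open V \<and> p \<in> V \<and> V \<subseteq> U \<and> (\<exists>s\<in>F V. \<phi> V s = restr V t)}"

definition short_exact ::
    "'r::finite sheaf \<Rightarrow> (point set \<Rightarrow> 'r sect \<Rightarrow> 'q sect) \<Rightarrow> 'q::finite sheaf \<Rightarrow>
     (point set \<Rightarrow> 'q sect \<Rightarrow> 'p sect) \<Rightarrow> 'p::finite sheaf \<Rightarrow> bool" where
  "short_exact E \<phi> F \<psi> G \<longleftrightarrow>
     sheaf_morphism E F \<phi> \<and> sheaf_morphism F G \<psi> \<and>
     (\<forall>U. zariski_open U \<longrightarrow>
        kernel_sheaf E \<phi> U = {\<lambda>_. 0} \<and>
        image_sheaf E F \<phi> U = kernel_sheaf F \<psi> U \<and>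
        image_sheaf F G \<psi> U = G U)"


subsection \<open>Line arrangements\<close>

definition linear_form :: "complex ^ 3 \<Rightarrow> complex ^ 3 \<Rightarrow> complex" where
  "linear_form c v = (\<Sum>i\<in>UNIV. c $ i * v $ i)"

definition line_of :: "complex ^ 3 \<Rightarrow> point set" where
  "line_of c = {p \<in> P2. \<forall>v\<in>p. linear_form c v = 0}"

definition arrangement :: "point set set \<Rightarrow> bool" where
  "arrangement A \<longleftrightarrow> finite A \<and> (\<forall>H\<in>A. \<exists>c. c \<noteq> 0 \<and> H = line_of c)"

text \<open>A defining form is unique up to a nonzero scalar, which does not affect the kernel below.\<close>

definition form_of :: "point set \<Rightarrow> complex ^ 3" where
  "form_of H = (SOME c. c \<noteq> 0 \<and> H = line_of c)"

definition defining_poly :: "point set set \<Rightarrow> complex ^ 3 \<Rightarrow> complex" where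
  "defining_poly A v = (\<Prod>H\<in>A. linear_form (form_of H) v)"

definition partial_deriv :: "3 \<Rightarrow> (complex ^ 3 \<Rightarrow> complex) \<Rightarrow> complex ^ 3 \<Rightarrow> complex" where
  "partial_deriv i f v = deriv (\<lambda>t. f (v + t *s axis i 1)) 0"

text \<open>
  On \<open>\<O>\<^sup>3\<close> and for \<open>f\<close> homogeneous of degree \<open>n\<close>, this is the morphism to \<open>\<O>(n - 1)\<close> given by the
  row of partial derivatives of \<open>f\<close>.
\<close>

definition gradient_map ::
    "(complex ^ 3 \<Rightarrow> complex) \<Rightarrow> point set \<Rightarrow> 3 sect \<Rightarrow> 1 sect" where
  "gradient_map f U s = (\<lambda>v. \<chi> _. \<Sum>i\<in>UNIV. partial_deriv i f v * s v $ i)"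

definition arrangement_bundle :: "point set set \<Rightarrow> 3 sheaf" where
  "arrangement_bundle A = kernel_sheaf (twist_sum 0) (gradient_map (defining_poly A))"

definition plus_one_generated :: "point set set \<Rightarrow> int \<Rightarrow> int \<Rightarrow> int \<Rightarrow> bool" where
  "plus_one_generated A a b d \<longleftrightarrow>
     a \<le> b \<and> b \<le> d \<and>
     (\<exists>\<phi> \<psi>. short_exact
        (twist_sum (vector [- 1 - d] :: int ^ 1)) \<phi>
        (twist_sum (vector [- d, - b, - a] :: int ^ 3)) \<psi>
        (arrangement_bundle A))"

definition intersection_points :: "point set \<Rightarrow> point set set \<Rightarrow> point set" where
  "intersection_points l A = {p \<in> l. \<exists>H\<in>A. H \<noteq> l \<and> p \<in> H}"

end

theory Submission
  imports Defs "HOL-Complex_Analysis.Cauchy_Integral_Formula"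
    "HOL-Computational_Algebra.Fundamental_Theorem_Algebra"
begin

text \<open>
  Restrict the bundle to the line \<open>l\<close>. A vector field annihilating the defining polynomial is tangent
  to every line of the arrangement, so along \<open>l\<close> it has, modulo the Euler field, a single component
  \<open>v \<and> \<theta>(v)\<close>, and this vanishes at the \<open>h\<close> intersection points. Dividing by these zeros gives a
  map from the bundle to \<open>\<O>\<^sub>l(1 - h)\<close>. It is surjective, because near each point of \<open>l\<close> a
  constant field, corrected by a multiple of the Euler field, hits a generator
  (\<open>reduced_wedges_no_common_zero\<close>, \<open>wedge_at_infinity\<close>). So the three generators of degrees \<open>d\<close>, \<open>b\<close>,
  \<open>a\<close> give binary forms \<open>q\<^sub>1\<close>, \<open>q\<^sub>2\<close>, \<open>q\<^sub>3\<close> on \<open>l\<close>, of degrees \<open>d + 1 - h\<close>, \<open>b + 1 - h\<close>, \<open>a + 1 - h\<close>, without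
  a common zero.

  Suppose \<open>h > a + 1\<close>. Then \<open>q\<^sub>3 = 0\<close>. If \<open>q\<^sub>2 = 0\<close> as well, then \<open>q\<^sub>1\<close> has no zero at all, so it is a
  constant and \<open>h = d + 1\<close>. Otherwise \<open>h \<le> b + 1\<close>. Assume moreover \<open>h < b\<close>. The relation
  \<open>L\<close> among the generators gives \<open>L\<^sub>1 q\<^sub>1 + L\<^sub>2 q\<^sub>2 = 0\<close> on \<open>l\<close>. Since \<open>q\<^sub>1\<close> and \<open>q\<^sub>2\<close> are coprime, \<open>q\<^sub>2\<close>, of
  degree at least \<open>2\<close>, divides the linear form \<open>L\<^sub>1\<close>; so \<open>L\<^sub>1\<close> and then \<open>L\<^sub>2\<close> vanish on \<open>l\<close>.
  As \<open>L\<^sub>3\<close> has the positive degree \<open>d + 1 - a\<close>, all of \<open>L\<close> vanishes at some point of \<open>l\<close>. This would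
  contradict that the cokernel of \<open>L\<close> is a vector bundle. The contradiction can be reached without
  local freeness. As \<open>L\<close> does not vanish on all of \<open>l\<close> (\<open>L_not_zero_on_line\<close>), the relation forces the
  third generator to vanish on \<open>l\<close>, hence to be divisible by the form of \<open>l\<close>. The quotient lies in the
  bundle, and expressing it in the generators produces a relation whose third entry is a unit at the
  points of \<open>l\<close>, although it is a multiple of \<open>L\<^sub>3\<close> (\<open>relation_not_concentrated_on_line\<close>).

  To speak of forms on \<open>l\<close>, the sheaf morphisms have to be described by functions. A morphism between
  sums of line bundles is a matrix of global regular functions (\<open>sheaf_morphism_matrix\<close>), and a
  global regular function restricts to a polynomial of the expected degree on every line, by
  Liouville's theorem (\<open>regular_on_line_poly\<close>).
\<close>

section \<open>Homogeneous polynomial functions\<close>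

lemma hom_poly_monomial:
  assumes "i + j + k = m"
  shows "hom_poly m (\<lambda>v. c * (v $ 1) ^ i * (v $ 2) ^ j * (v $ 3) ^ k)"
  unfolding hom_poly_def
proof (intro exI allI)
  fix v :: "complex ^ 3"
  have inner: "(\<Sum>j'\<le>m - i'. (if i' = i \<and> j' = j then c else 0) *
          (v $ 1) ^ i' * (v $ 2) ^ j' * (v $ 3) ^ (m - i' - j'))
      = (if i' = i then c * (v $ 1) ^ i * (v $ 2) ^ j * (v $ 3) ^ k else 0)" for i'
  proof -
    have "(\<Sum>j'\<le>m - i'. (if i' = i \<and> j' = j then c else 0) *
          (v $ 1) ^ i' * (v $ 2) ^ j' * (v $ 3) ^ (m - i' - j'))
        = (\<Sum>j'\<le>m - i'. if j' = j then
            (if i' = i then c * (v $ 1) ^ i * (v $ 2) ^ j * (v $ 3) ^ k else 0) else 0)"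
      using assms by (intro sum.cong) auto
    also have "\<dots> = (if i' = i then c * (v $ 1) ^ i * (v $ 2) ^ j * (v $ 3) ^ k else 0)"
      using assms by auto
    finally show ?thesis .
  qed
  have "(\<Sum>i'\<le>m. \<Sum>j'\<le>m - i'. (if i' = i \<and> j' = j then c else 0) *
          (v $ 1) ^ i' * (v $ 2) ^ j' * (v $ 3) ^ (m - i' - j'))
      = c * (v $ 1) ^ i * (v $ 2) ^ j * (v $ 3) ^ k"
    unfolding inner using assms by simp
  then show "c * (v $ 1) ^ i * (v $ 2) ^ j * (v $ 3) ^ k =
      (\<Sum>i'\<le>m. \<Sum>j'\<le>m - i'. (if i' = i \<and> j' = j then c else 0) *
          (v $ 1) ^ i' * (v $ 2) ^ j' * (v $ 3) ^ (m - i' - j'))" ..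
qed

lemma hom_poly_const: "hom_poly 0 (\<lambda>_. c)"
  using hom_poly_monomial[of 0 0 0 0 c] by simp

lemma hom_poly_zero: "hom_poly m (\<lambda>_. 0)"
  unfolding hom_poly_def by (rule exI[of _ "\<lambda>_ _. 0"]) simp

lemma hom_poly_add:
  assumes "hom_poly m g" "hom_poly m h"
  shows "hom_poly m (\<lambda>v. g v + h v)"
proof -
  obtain c e where c: "\<And>v. g v = (\<Sum>i\<le>m. \<Sum>j\<le>m - i. c i j * (v $ 1) ^ i * (v $ 2) ^ j * (v $ 3) ^ (m - i - j))"
    and e: "\<And>v. h v = (\<Sum>i\<le>m. \<Sum>j\<le>m - i. e i j * (v $ 1) ^ i * (v $ 2) ^ j * (v $ 3) ^ (m - i - j))"
    using assms unfolding hom_poly_def by blast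
  show ?thesis
    unfolding hom_poly_def c e
    by (rule exI[of _ "\<lambda>i j. c i j + e i j"]) (simp add: sum.distrib algebra_simps)
qed

lemma hom_poly_sum:
  assumes "finite I" "\<And>i. i \<in> I \<Longrightarrow> hom_poly m (g i)"
  shows "hom_poly m (\<lambda>v. \<Sum>i\<in>I. g i v)"
  using assms by (induction I rule: finite_induct) (auto intro: hom_poly_zero hom_poly_add)

text \<open>Monomials are built from the coordinates one factor at a time, so a property that holds for
  constants and survives sums and multiplication by a coordinate holds for every form.\<close>

lemma hom_poly_induct [consumes 1, case_names const coord add]:
  assumes g: "hom_poly m g"
    and const: "\<And>c. R 0 (\<lambda>_. c)"
    and coord: "\<And>m g i. hom_poly m g \<Longrightarrow> R m g \<Longrightarrow> R (Suc m) (\<lambda>v. v $ i * g v)"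
    and add: "\<And>m g h. hom_poly m g \<Longrightarrow> hom_poly m h \<Longrightarrow> R m g \<Longrightarrow> R m h \<Longrightarrow> R m (\<lambda>v. g v + h v)"
  shows "R m g"
proof -
  have mono: "R (i + j + k) (\<lambda>v. c * (v $ 1) ^ i * (v $ 2) ^ j * (v $ 3) ^ k)" for c i j k
  proof (induction i)
    case 0
    show ?case
    proof (induction j)
      case 0
      show ?case
      proof (induction k)
        case 0
        show ?case using const[of c] by simp
      next
        case (Suc k)
        then show ?case
          using coord[of "0 + 0 + k" "\<lambda>v. c * (v $ 1) ^ 0 * (v $ 2) ^ 0 * (v $ 3) ^ k" 3]
            hom_poly_monomial[of 0 0 k k c] by (simp add: mult_ac)
      qed
    next
      case (Suc j)
      then show ?case
        using coord[of "0 + j + k" "\<lambda>v. c * (v $ 1) ^ 0 * (v $ 2) ^ j * (v $ 3) ^ k" 2]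
          hom_poly_monomial[of 0 j k "j + k" c] by (simp add: mult_ac)
    qed
  next
    case (Suc i)
    then show ?case
      using coord[of "i + j + k" "\<lambda>v. c * (v $ 1) ^ i * (v $ 2) ^ j * (v $ 3) ^ k" 1]
        hom_poly_monomial[of i j k "i + j + k" c] by (simp add: mult_ac)
  qed
  have zero: "R m (\<lambda>_. 0)" for m
    using mono[of 0 0 m 0] by simp
  have sums: "hom_poly m (\<lambda>v. \<Sum>i\<in>I. g i v) \<and> R m (\<lambda>v. \<Sum>i\<in>I. g i v)"
    if "finite I" "\<And>i. i \<in> I \<Longrightarrow> hom_poly m (g i) \<and> R m (g i)" for m :: nat and I :: "nat set" and g
    using that
  proof (induction I rule: finite_induct)
    case empty
    then show ?case by (simp add: hom_poly_zero zero)
  next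
    case (insert x F)
    then show ?case
      using add[of m "g x" "\<lambda>v. \<Sum>i\<in>F. g i v"] hom_poly_add[of m "g x" "\<lambda>v. \<Sum>i\<in>F. g i v"] by simp
  qed
  obtain c where c: "\<And>v. g v = (\<Sum>i\<le>m. \<Sum>j\<le>m - i. c i j * (v $ 1) ^ i * (v $ 2) ^ j * (v $ 3) ^ (m - i - j))"
    using g unfolding hom_poly_def by blast
  have "hom_poly m (\<lambda>v. c i j * (v $ 1) ^ i * (v $ 2) ^ j * (v $ 3) ^ (m - i - j)) \<and>
      R m (\<lambda>v. c i j * (v $ 1) ^ i * (v $ 2) ^ j * (v $ 3) ^ (m - i - j))" if "i \<le> m" "j \<le> m - i" for i j
    using mono[of i j "m - i - j" "c i j"] hom_poly_monomial[of i j "m - i - j" m "c i j"] that by simp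
  then have "R m (\<lambda>v. \<Sum>i\<le>m. \<Sum>j\<le>m - i. c i j * (v $ 1) ^ i * (v $ 2) ^ j * (v $ 3) ^ (m - i - j))"
    by (intro conjunct2[OF sums] sums) auto
  then show ?thesis
    unfolding c[abs_def] .
qed

lemma hom_poly_coord_mult:
  assumes "hom_poly m g"
  shows "hom_poly (Suc m) (\<lambda>v. v $ l * g v)"
proof -
  obtain c where c: "\<And>v. g v = (\<Sum>i\<le>m. \<Sum>j\<le>m - i. c i j * (v $ 1) ^ i * (v $ 2) ^ j * (v $ 3) ^ (m - i - j))"
    using assms unfolding hom_poly_def by blast
  have "hom_poly (Suc m) (\<lambda>v. v $ l * (c i j * (v $ 1) ^ i * (v $ 2) ^ j * (v $ 3) ^ (m - i - j)))"
    if "i \<le> m" "j \<le> m - i" for i j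
  proof -
    consider "l = 1" | "l = 2" | "l = 3"
      using exhaust_3[of l] by blast
    then show ?thesis
    proof cases
      case 1
      then show ?thesis
        using hom_poly_monomial[of "Suc i" j "m - i - j" "Suc m" "c i j"] that by (simp add: mult_ac)
    next
      case 2
      then show ?thesis
        using hom_poly_monomial[of i "Suc j" "m - i - j" "Suc m" "c i j"] that by (simp add: mult_ac)
    next
      case 3
      then show ?thesis
        using hom_poly_monomial[of i j "Suc (m - i - j)" "Suc m" "c i j"] that by (simp add: mult_ac)
    qed
  qed
  then show ?thesis
    unfolding c sum_distrib_left by (intro hom_poly_sum) auto
qed

lemma hom_poly_coord: "hom_poly 1 (\<lambda>v. v $ l)"
  using hom_poly_coord_mult[OF hom_poly_const[of 1]] by simp

lemma hom_poly_cmult: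
  assumes "hom_poly m g"
  shows "hom_poly m (\<lambda>v. c * g v)"
  using assms
proof (induction rule: hom_poly_induct)
  case (const e)
  show ?case by (rule hom_poly_const)
next
  case (coord m g i)
  then show ?case using hom_poly_coord_mult[of m "\<lambda>v. c * g v" i] by (simp add: mult_ac)
next
  case (add m g h)
  then show ?case using hom_poly_add[of m "\<lambda>v. c * g v" "\<lambda>v. c * h v"] by (simp add: algebra_simps)
qed

lemma hom_poly_mult:
  assumes "hom_poly m g" "hom_poly n h"
  shows "hom_poly (m + n) (\<lambda>v. g v * h v)"
  using assms(1)
proof (induction rule: hom_poly_induct)
  case (const e)
  show ?case using hom_poly_cmult[OF assms(2)] by simp
next
  case (coord m g i)
  then show ?case using hom_poly_coord_mult[of "m + n" "\<lambda>v. g v * h v" i] by (simp add: mult_ac)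
next
  case (add m g g')
  then show ?case using hom_poly_add[of "m + n" "\<lambda>v. g v * h v" "\<lambda>v. g' v * h v"] by (simp add: algebra_simps)
qed

lemma hom_poly_power:
  assumes "hom_poly m g"
  shows "hom_poly (n * m) (\<lambda>v. g v ^ n)"
  by (induction n) (use hom_poly_const[of 1] hom_poly_mult[OF assms] in auto)

lemma hom_poly_linear_form: "hom_poly 1 (linear_form c)"
  unfolding linear_form_def[abs_def] by (intro hom_poly_sum hom_poly_cmult hom_poly_coord) simp

lemma hom_poly_scale:
  assumes "hom_poly m g"
  shows "g (k *s v) = k ^ m * g v"
  using assms
  by (induction rule: hom_poly_induct) (auto simp: algebra_simps)

lemma continuous_hom_poly:
  assumes "hom_poly m g"
  shows "continuous_on UNIV g"
  using assms
  by (induction rule: hom_poly_induct) (auto intro!: continuous_intros)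

lemma isCont_hom_poly: "hom_poly m g \<Longrightarrow> isCont g v"
  using continuous_hom_poly continuous_on_eq_continuous_at open_UNIV by blast

lemma linear_form_add: "linear_form c (v + w) = linear_form c v + linear_form c w"
  and linear_form_diff: "linear_form c (v - w) = linear_form c v - linear_form c w"
  and linear_form_scale: "linear_form c (k *s v) = k * linear_form c v"
  and linear_form_zero: "linear_form c 0 = 0"
  by (simp_all add: linear_form_def algebra_simps sum.distrib sum_subtractf sum_distrib_left)

lemmas linear_form_simps = linear_form_add linear_form_diff linear_form_scale linear_form_zero

lemma linear_form_axis: "linear_form c (axis i 1) = c $ i"
  by (simp add: linear_form_def axis_def sum.delta if_distrib cong: if_cong)

lemma hom_poly_on_line:
  assumes "hom_poly m g"
  shows "\<exists>p. \<forall>t. g (u + t *s w) = poly p t"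
  using assms
proof (induction rule: hom_poly_induct)
  case (const c)
  show ?case by (rule exI[of _ "[:c:]"]) simp
next
  case (coord m g i)
  then obtain p where "\<forall>t. g (u + t *s w) = poly p t" by blast
  then show ?case by (intro exI[of _ "[:u $ i, w $ i:] * p"]) (simp add: algebra_simps)
next
  case (add m g h)
  then obtain p q where "\<forall>t. g (u + t *s w) = poly p t" "\<forall>t. h (u + t *s w) = poly q t" by blast
  then show ?case by (intro exI[of _ "p + q"]) simp
qed

text \<open>Moving \<open>v\<close> along \<open>z\<close> by the amount \<open>linear_form c v\<close> changes each coordinate by a multiple of the
  linear form, and the product rule for differences passes this on to all forms. If
  \<open>linear_form c z = 1\<close>, the moved vector lies in the plane where the linear form vanishes.\<close>

lemma hom_poly_translate:
  assumes "hom_poly m g"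
  shows "hom_poly m (\<lambda>v. g (v - linear_form c v *s z)) \<and>
    (\<exists>g'. (\<forall>v. g v - g (v - linear_form c v *s z) = linear_form c v * g' v) \<and>
      (if m = 0 then g' = (\<lambda>_. 0) else hom_poly (m - 1) g'))"
  using assms
proof (induction rule: hom_poly_induct)
  case (const e)
  show ?case by (auto intro: hom_poly_const)
next
  case (coord m g i)
  let ?r = "\<lambda>v. v - linear_form c v *s z"
  from coord obtain g' where r: "hom_poly m (\<lambda>v. g (?r v))"
    and g': "\<And>v. g v - g (?r v) = linear_form c v * g' v"
    and deg: "if m = 0 then g' = (\<lambda>_. 0) else hom_poly (m - 1) g'" by blast
  have deg': "hom_poly m (\<lambda>v. v $ i * g' v)"
    using deg hom_poly_coord_mult[of "m - 1" g' i] by (cases "m = 0") (auto simp: hom_poly_zero)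
  have "hom_poly 1 (\<lambda>v. v $ i + (- z $ i) * linear_form c v)"
    by (intro hom_poly_add hom_poly_coord hom_poly_cmult hom_poly_linear_form)
  from hom_poly_mult[OF this r]
  have 1: "hom_poly (Suc m) (\<lambda>v. ?r v $ i * g (?r v))"
    by (simp add: mult.commute)
  have 2: "hom_poly m (\<lambda>v. v $ i * g' v + z $ i * g (?r v))"
    by (intro hom_poly_add deg' hom_poly_cmult r)
  have 3: "v $ i * g v - ?r v $ i * g (?r v) =
      linear_form c v * (v $ i * g' v + z $ i * g (?r v))" for v
  proof -
    have "v $ i * g v - ?r v $ i * g (?r v) =
        v $ i * (g v - g (?r v)) + linear_form c v * z $ i * g (?r v)"
      by (simp add: algebra_simps)
    then show ?thesis unfolding g' by (simp add: algebra_simps)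
  qed
  show ?case
    using 1 2 3 by (intro conjI exI[of _ "\<lambda>v. v $ i * g' v + z $ i * g (?r v)"]) auto
next
  case (add m g h)
  let ?r = "\<lambda>v. v - linear_form c v *s z"
  from add obtain g' h' where r: "hom_poly m (\<lambda>v. g (?r v))" "hom_poly m (\<lambda>v. h (?r v))"
    and g': "\<And>v. g v - g (?r v) = linear_form c v * g' v" "\<And>v. h v - h (?r v) = linear_form c v * h' v"
    and deg: "if m = 0 then g' = (\<lambda>_. 0) else hom_poly (m - 1) g'"
      "if m = 0 then h' = (\<lambda>_. 0) else hom_poly (m - 1) h'" by blast
  have 3: "g v + h v - (g (?r v) + h (?r v)) = linear_form c v * (g' v + h' v)" for v
    using g'[of v] by (simp add: algebra_simps)
  show ?case
    using r deg 3 by (intro conjI exI[of _ "\<lambda>v. g' v + h' v"] hom_poly_add)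
      (auto intro: hom_poly_add split: if_splits)
qed

lemma exists_linear_form_eq_1:
  assumes "c \<noteq> 0"
  obtains z where "linear_form c z = 1"
proof -
  obtain i where "c $ i \<noteq> 0"
    using assms by (auto simp: vec_eq_iff)
  then have "linear_form c ((1 / c $ i) *s axis i 1) = 1"
    by (simp add: linear_form_simps linear_form_axis)
  then show thesis by (rule that)
qed

lemma linear_form_dvd:
  assumes g: "hom_poly m g" and "c \<noteq> 0" and zero: "\<And>v. linear_form c v = 0 \<Longrightarrow> g v = 0"
  shows "\<exists>g'. (\<forall>v. g v = linear_form c v * g' v) \<and> (if m = 0 then g' = (\<lambda>_. 0) else hom_poly (m - 1) g')"
proof -
  obtain z where z: "linear_form c z = 1"
    using exists_linear_form_eq_1[OF \<open>c \<noteq> 0\<close>] .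
  have "g (v - linear_form c v *s z) = 0" for v
    by (rule zero) (simp add: linear_form_simps z)
  with hom_poly_translate[OF g, of c z] show ?thesis by simp
qed

section \<open>Regular functions and Zariski open sets\<close>

lemma zariski_open_cone:
  assumes "zariski_open U"
  obtains G where "\<And>g. g \<in> G \<Longrightarrow> \<exists>m. hom_poly m g"
    and "cone U = {v. v \<noteq> 0 \<and> (\<exists>g\<in>G. g v \<noteq> 0)}"
proof -
  obtain G where G: "\<forall>g\<in>G. \<exists>m. hom_poly m g" and U: "U = {p \<in> P2. \<exists>g\<in>G. \<exists>v\<in>p. g v \<noteq> 0}"
    using assms unfolding zariski_open_def by blast
  have "(\<exists>v'\<in>vec.span {v}. g v' \<noteq> 0) \<longleftrightarrow> g v \<noteq> 0" if "g \<in> G" for g and v :: "complex ^ 3"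
  proof
    assume "\<exists>v'\<in>vec.span {v}. g v' \<noteq> 0"
    then obtain k where "g (k *s v) \<noteq> 0" by (auto simp: vec.span_singleton)
    moreover obtain m where "hom_poly m g" using G \<open>g \<in> G\<close> by blast
    ultimately show "g v \<noteq> 0" using hom_poly_scale[of m g k v] by auto
  next
    assume "g v \<noteq> 0"
    then show "\<exists>v'\<in>vec.span {v}. g v' \<noteq> 0"
      using vec.span_base[of v "{v}"] by blast
  qed
  then have "cone U = {v. v \<noteq> 0 \<and> (\<exists>g\<in>G. g v \<noteq> 0)}"
    unfolding cone_def U P2_def by blast
  with G show thesis by (intro that) auto
qed

lemma zariski_open_subset_P2: "zariski_open U \<Longrightarrow> U \<subseteq> P2"
  unfolding zariski_open_def by blast

lemma zariski_open_point:
  assumes "zariski_open U" "p \<in> U"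
  obtains v where "v \<in> cone U" "p = vec.span {v}"
  using assms zariski_open_subset_P2[of U] unfolding cone_def P2_def by blast

definition nonvanishing :: "(complex ^ 3 \<Rightarrow> complex) \<Rightarrow> point set" where
  "nonvanishing g = {p \<in> P2. \<exists>v\<in>p. g v \<noteq> 0}"

lemma zariski_open_nonvanishing: "hom_poly m g \<Longrightarrow> zariski_open (nonvanishing g)"
  unfolding zariski_open_def nonvanishing_def by (rule exI[of _ "{g}"]) auto

lemma cone_nonvanishing:
  assumes "hom_poly m g"
  shows "cone (nonvanishing g) = {v. v \<noteq> 0 \<and> g v \<noteq> 0}"
proof -
  have "(\<exists>v'\<in>vec.span {v}. g v' \<noteq> 0) \<longleftrightarrow> g v \<noteq> 0" for v :: "complex ^ 3"
    using hom_poly_scale[OF assms] vec.span_base[of v "{v}"] by (auto simp: vec.span_singleton)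
  then show ?thesis
    unfolding cone_def nonvanishing_def P2_def by blast
qed

lemma cone_Int: "cone (U \<inter> V) = cone U \<inter> cone V"
  by (auto simp: cone_def)

lemma zariski_open_Int:
  assumes "zariski_open U" "zariski_open V"
  shows "zariski_open (U \<inter> V)"
proof -
  obtain G where G: "\<And>g. g \<in> G \<Longrightarrow> \<exists>m. hom_poly m g" and U: "cone U = {v. v \<noteq> 0 \<and> (\<exists>g\<in>G. g v \<noteq> 0)}"
    using zariski_open_cone[OF assms(1)] by blast
  obtain H where H: "\<And>h. h \<in> H \<Longrightarrow> \<exists>m. hom_poly m h" and V: "cone V = {v. v \<noteq> 0 \<and> (\<exists>h\<in>H. h v \<noteq> 0)}"
    using zariski_open_cone[OF assms(2)] by blast
  define K where "K = (\<lambda>(g, h) v. g v * h v) ` (G \<times> H)"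
  define W where "W = {p \<in> P2. \<exists>k\<in>K. \<exists>v\<in>p. k v \<noteq> 0}"
  have K: "\<exists>m. hom_poly m k" if "k \<in> K" for k
    using that G H hom_poly_mult unfolding K_def by fastforce
  then have W: "zariski_open W"
    unfolding zariski_open_def W_def by blast
  have "(\<exists>v'\<in>vec.span {v}. k v' \<noteq> 0) \<longleftrightarrow> k v \<noteq> 0" if k: "k \<in> K" for k and v :: "complex ^ 3"
    using K[OF k] hom_poly_scale vec.span_base[of v "{v}"] by (fastforce simp: vec.span_singleton)
  then have "cone W = {v. v \<noteq> 0 \<and> (\<exists>k\<in>K. k v \<noteq> 0)}"
    unfolding cone_def W_def P2_def by blast
  also have "\<dots> = cone (U \<inter> V)"
    unfolding cone_Int U V K_def by auto
  finally have "cone W = cone (U \<inter> V)" .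
  moreover have "U \<inter> V \<subseteq> P2" using zariski_open_subset_P2[OF assms(1)] by blast
  ultimately have "W = U \<inter> V"
    using zariski_open_subset_P2[OF W] unfolding cone_def P2_def by blast
  then show ?thesis using W by simp
qed

lemma open_cone:
  assumes "zariski_open U"
  shows "open (cone U)"
proof -
  obtain G where G: "\<And>g. g \<in> G \<Longrightarrow> \<exists>m. hom_poly m g" and U: "cone U = {v. v \<noteq> 0 \<and> (\<exists>g\<in>G. g v \<noteq> 0)}"
    using zariski_open_cone[OF assms] by blast
  have "open {v. g v \<noteq> 0}" if "g \<in> G" for g
    using G[OF that] continuous_hom_poly by (auto intro!: open_Collect_neq)
  then have "open (- {0} \<inter> (\<Union>g\<in>G. {v. g v \<noteq> 0}))"
    by (intro open_Int open_UN) auto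
  also have "- {0} \<inter> (\<Union>g\<in>G. {v. g v \<noteq> 0}) = cone U"
    unfolding U by auto
  finally show ?thesis .
qed

lemma zero_notin_cone: "0 \<notin> cone U"
  by (simp add: cone_def)

text \<open>A function on a set of vectors that near each vector (in the Zariski topology) is a quotient of
  forms of degree difference \<open>k\<close>. Unlike for sections, nothing is required off the set, so regular
  functions restrict to subsets without change.\<close>

definition regular :: "int \<Rightarrow> (complex ^ 3) set \<Rightarrow> (complex ^ 3 \<Rightarrow> complex) \<Rightarrow> bool" where
  "regular k C s \<longleftrightarrow> (\<forall>v\<in>C. \<exists>P Q i j. hom_poly i P \<and> hom_poly j Q \<and> int i - int j = k \<and> Q v \<noteq> 0 \<and>
     (\<forall>x\<in>C. Q x \<noteq> 0 \<longrightarrow> s x = P x / Q x))"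

lemma regularE:
  assumes "regular k C s" "v \<in> C"
  obtains i P j Q where "hom_poly i P" "hom_poly j Q" "int i - int j = k" "Q v \<noteq> 0"
    "\<forall>x\<in>C. Q x \<noteq> 0 \<longrightarrow> s x = P x / Q x"
proof -
  from assms have "\<exists>P Q i j. hom_poly i P \<and> hom_poly j Q \<and> int i - int j = k \<and> Q v \<noteq> 0 \<and>
     (\<forall>x\<in>C. Q x \<noteq> 0 \<longrightarrow> s x = P x / Q x)"
    unfolding regular_def by (rule bspec)
  then show thesis
    by (elim exE conjE) (rule that, auto)
qed

lemma regular_quotientI:
  assumes "hom_poly i P" "hom_poly j Q" "int i - int j = k" "\<And>x. x \<in> C \<Longrightarrow> Q x \<noteq> 0 \<and> s x = P x / Q x"
  shows "regular k C s"
  unfolding regular_def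
proof
  fix v assume "v \<in> C"
  with assms show "\<exists>P Q i j. hom_poly i P \<and> hom_poly j Q \<and> int i - int j = k \<and> Q v \<noteq> 0 \<and>
     (\<forall>x\<in>C. Q x \<noteq> 0 \<longrightarrow> s x = P x / Q x)"
    by (intro exI[of _ P] exI[of _ Q] exI[of _ i] exI[of _ j]) auto
qed

lemma regular_cong_subset:
  assumes s: "regular k C s" and "D \<subseteq> C" "\<And>x. x \<in> D \<Longrightarrow> s x = t x"
  shows "regular k D t"
  unfolding regular_def
proof
  fix v assume v: "v \<in> D"
  then have "v \<in> C" using assms by blast
  then obtain P Q i j where PQ: "hom_poly i P" "hom_poly j Q" "int i - int j = k" "Q v \<noteq> 0"
    and eq: "\<forall>x\<in>C. Q x \<noteq> 0 \<longrightarrow> s x = P x / Q x"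
    by (rule regularE[OF s]) (rule that)
  have "\<forall>x\<in>D. Q x \<noteq> 0 \<longrightarrow> t x = P x / Q x"
    using eq assms(2,3) by (metis subsetD)
  with PQ show "\<exists>P Q i j. hom_poly i P \<and> hom_poly j Q \<and> int i - int j = k \<and> Q v \<noteq> 0 \<and>
     (\<forall>x\<in>D. Q x \<noteq> 0 \<longrightarrow> t x = P x / Q x)"
    by (intro exI conjI)
qed

lemma regular_subset: "regular k C s \<Longrightarrow> D \<subseteq> C \<Longrightarrow> regular k D s"
  using regular_cong_subset[of k C s D s] by blast

lemma regular_cong: "regular k C s \<Longrightarrow> (\<And>x. x \<in> C \<Longrightarrow> s x = t x) \<Longrightarrow> regular k C t"
  using regular_cong_subset[of k C s C t] by blast

lemma regular_local:
  assumes "\<And>v. v \<in> C \<Longrightarrow> \<exists>m g. hom_poly m g \<and> g v \<noteq> 0 \<and> regular k {x \<in> C. g x \<noteq> 0} s"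
  shows "regular k C s"
  unfolding regular_def
proof
  fix v assume v: "v \<in> C"
  then obtain m g where g: "hom_poly m g" "g v \<noteq> 0" and s: "regular k {x \<in> C. g x \<noteq> 0} s"
    using assms by blast
  have "v \<in> {x \<in> C. g x \<noteq> 0}" using v g(2) by simp
  then obtain P Q i j where PQ: "hom_poly i P" "hom_poly j Q" "int i - int j = k" "Q v \<noteq> 0"
    and eq: "\<forall>x\<in>{x \<in> C. g x \<noteq> 0}. Q x \<noteq> 0 \<longrightarrow> s x = P x / Q x"
    by (rule regularE[OF s]) (rule that)
  show "\<exists>P Q i j. hom_poly i P \<and> hom_poly j Q \<and> int i - int j = k \<and> Q v \<noteq> 0 \<and>
     (\<forall>x\<in>C. Q x \<noteq> 0 \<longrightarrow> s x = P x / Q x)"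
    using hom_poly_mult[OF g(1) PQ(1)] hom_poly_mult[OF g(1) PQ(2)] PQ(3,4) g(2) eq
    by (intro exI[of _ "\<lambda>x. g x * P x"] exI[of _ "\<lambda>x. g x * Q x"] exI[of _ "m + i"] exI[of _ "m + j"]) auto
qed

lemma regular_hom_poly: "hom_poly m g \<Longrightarrow> regular (int m) C g"
  by (rule regular_quotientI[OF _ hom_poly_const[of 1]]) auto

lemma regular_mult:
  assumes "regular k C s" "regular l C t"
  shows "regular (k + l) C (\<lambda>v. s v * t v)"
  unfolding regular_def
proof
  fix v assume v: "v \<in> C"
  obtain P Q i j where 1: "hom_poly i P" "hom_poly j Q" "int i - int j = k" "Q v \<noteq> 0"
    and s: "\<forall>x\<in>C. Q x \<noteq> 0 \<longrightarrow> s x = P x / Q x"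
    by (rule regularE[OF assms(1) v]) (rule that)
  obtain P' Q' i' j' where 2: "hom_poly i' P'" "hom_poly j' Q'" "int i' - int j' = l" "Q' v \<noteq> 0"
    and t: "\<forall>x\<in>C. Q' x \<noteq> 0 \<longrightarrow> t x = P' x / Q' x"
    by (rule regularE[OF assms(2) v]) (rule that)
  show "\<exists>P Q i j. hom_poly i P \<and> hom_poly j Q \<and> int i - int j = k + l \<and> Q v \<noteq> 0 \<and>
     (\<forall>x\<in>C. Q x \<noteq> 0 \<longrightarrow> s x * t x = P x / Q x)"
    using hom_poly_mult[OF 1(1) 2(1)] hom_poly_mult[OF 1(2) 2(2)] 1(3,4) 2(3,4) s t
    by (intro exI[of _ "\<lambda>x. P x * P' x"] exI[of _ "\<lambda>x. Q x * Q' x"] exI[of _ "i + i'"] exI[of _ "j + j'"]) auto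
qed

lemma regular_add:
  assumes "regular k C s" "regular k C t"
  shows "regular k C (\<lambda>v. s v + t v)"
  unfolding regular_def
proof
  fix v assume v: "v \<in> C"
  obtain P Q i j where 1: "hom_poly i P" "hom_poly j Q" "int i - int j = k" "Q v \<noteq> 0"
    and s: "\<forall>x\<in>C. Q x \<noteq> 0 \<longrightarrow> s x = P x / Q x"
    by (rule regularE[OF assms(1) v]) (rule that)
  obtain P' Q' i' j' where 2: "hom_poly i' P'" "hom_poly j' Q'" "int i' - int j' = k" "Q' v \<noteq> 0"
    and t: "\<forall>x\<in>C. Q' x \<noteq> 0 \<longrightarrow> t x = P' x / Q' x"
    by (rule regularE[OF assms(2) v]) (rule that)
  have "j + i' = i + j'" using 1(3) 2(3) by linarith
  then have "hom_poly (i + j') (\<lambda>x. P x * Q' x + Q x * P' x)"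
    using hom_poly_add[OF hom_poly_mult[OF 1(1) 2(2)]] hom_poly_mult[OF 1(2) 2(1)] by simp
  then show "\<exists>P Q i j. hom_poly i P \<and> hom_poly j Q \<and> int i - int j = k \<and> Q v \<noteq> 0 \<and>
     (\<forall>x\<in>C. Q x \<noteq> 0 \<longrightarrow> s x + t x = P x / Q x)"
    using hom_poly_mult[OF 1(2) 2(2)] 1(3,4) 2(3,4) s t
    by (intro exI[of _ "\<lambda>x. P x * Q' x + Q x * P' x"] exI[of _ "\<lambda>x. Q x * Q' x"] exI[of _ "i + j'"] exI[of _ "j + j'"])
      (auto simp: field_simps)
qed

lemma hom_poly_power_int_parts:
  assumes "hom_poly 1 m"
  obtains P Q i j where "hom_poly i P" "hom_poly j Q" "int i - int j = k"
    "\<And>v. m v \<noteq> 0 \<Longrightarrow> Q v \<noteq> 0 \<and> m v powi k = P v / Q v"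
proof (cases "k \<ge> 0")
  case True
  then show thesis
    using hom_poly_power[OF assms, of "nat k"] hom_poly_const[of 1]
    by (intro that[of "nat k" "\<lambda>v. m v ^ nat k" 0 "\<lambda>_. 1"]) (auto simp: power_int_def)
next
  case False
  then show thesis
    using hom_poly_power[OF assms, of "nat (- k)"] hom_poly_const[of 1]
    by (intro that[of 0 "\<lambda>_. 1" "nat (- k)" "\<lambda>v. m v ^ nat (- k)"]) (auto simp: power_int_def field_simps)
qed

lemma regular_power_int:
  assumes "hom_poly 1 m" "\<And>v. v \<in> C \<Longrightarrow> m v \<noteq> 0"
  shows "regular k C (\<lambda>v. m v powi k)"
proof -
  obtain P Q i j where "hom_poly i P" "hom_poly j Q" "int i - int j = k"
    "\<And>v. m v \<noteq> 0 \<Longrightarrow> Q v \<noteq> 0 \<and> m v powi k = P v / Q v"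
    using hom_poly_power_int_parts[OF assms(1)] by metis
  then show ?thesis
    using assms(2) by (intro regular_quotientI) auto
qed

lemma regular_const: "regular 0 C (\<lambda>_. c)"
  using regular_hom_poly[OF hom_poly_const[of c]] by simp

lemma regular_cmult: "regular k C s \<Longrightarrow> regular k C (\<lambda>v. c * s v)"
  using regular_mult[OF regular_const, of k C s c] by simp

lemma regular_diff: "regular k C s \<Longrightarrow> regular k C t \<Longrightarrow> regular k C (\<lambda>v. s v - t v)"
  using regular_add[of k C s "\<lambda>v. (-1) * t v"] regular_cmult[of k C t "-1"] by simp

lemma exists_coord_nonzero: "v \<noteq> 0 \<Longrightarrow> \<exists>i. v $ i \<noteq> (0 :: complex)"
  by (auto simp: vec_eq_iff)

lemma regular_zero:
  assumes "0 \<notin> C"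
  shows "regular k C (\<lambda>_. 0)"
proof (rule regular_local)
  fix v assume "v \<in> C"
  with assms obtain i where i: "v $ i \<noteq> 0" using exists_coord_nonzero[of v] by auto
  have "regular k {x \<in> C. x $ i \<noteq> 0} (\<lambda>x. 0 * (x $ i) powi k)"
    by (intro regular_cmult regular_power_int[OF hom_poly_coord]) auto
  then show "\<exists>m g. hom_poly m g \<and> g v \<noteq> 0 \<and> regular k {x \<in> C. g x \<noteq> 0} (\<lambda>_. 0)"
    using i hom_poly_coord[of i] by (intro exI[of _ 1] exI[of _ "\<lambda>x. x $ i"]) auto
qed

lemma regular_sum:
  assumes "finite I" "0 \<notin> C" "\<And>i. i \<in> I \<Longrightarrow> regular k C (s i)"
  shows "regular k C (\<lambda>v. \<Sum>i\<in>I. s i v)"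
  using assms(1,3) by (induction I rule: finite_induct) (simp_all add: regular_zero regular_add assms(2))

lemma regular_linear_form:
  assumes "0 \<notin> C" "\<And>i. regular k C (\<lambda>v. s v $ i)"
  shows "regular k C (\<lambda>v. linear_form c (s v))"
  unfolding linear_form_def by (intro regular_sum regular_cmult assms finite)

lemma isCont_regular:
  assumes s: "regular k C s" and "open C" "v \<in> C"
  shows "isCont s v"
proof -
  obtain P Q i j where PQ: "hom_poly i P" "hom_poly j Q" and "int i - int j = k" and Qv: "Q v \<noteq> 0"
    and eq: "\<forall>x\<in>C. Q x \<noteq> 0 \<longrightarrow> s x = P x / Q x"
    by (rule regularE[OF s \<open>v \<in> C\<close>]) (rule that)
  have "isCont (\<lambda>x. P x / Q x) v"
    using PQ Qv by (intro continuous_intros isCont_hom_poly)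
  moreover have "open {x. Q x \<noteq> 0}"
    using continuous_hom_poly[OF PQ(2)] by (auto intro!: open_Collect_neq)
  then have "\<forall>\<^sub>F x in nhds v. x \<in> C \<inter> {x. Q x \<noteq> 0}"
    using assms(2,3) Qv by (intro eventually_nhds_in_open) auto
  then have "\<forall>\<^sub>F x in nhds v. s x = P x / Q x"
    by eventually_elim (auto simp: eq)
  ultimately show ?thesis
    using isCont_cong[of s "\<lambda>x. P x / Q x" v] by blast
qed

lemma regular_scale:
  assumes s: "regular k C s" and "v \<in> C" "r *s v \<in> C" "r \<noteq> 0"
  shows "s (r *s v) = r powi k * s v"
proof -
  obtain P Q i j where PQ: "hom_poly i P" "hom_poly j Q" and k: "int i - int j = k" and Qv: "Q v \<noteq> 0"
    and eq: "\<forall>x\<in>C. Q x \<noteq> 0 \<longrightarrow> s x = P x / Q x"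
    by (rule regularE[OF s \<open>v \<in> C\<close>]) (rule that)
  have "r powi k = r ^ i / r ^ j"
    using \<open>r \<noteq> 0\<close> by (simp flip: k add: power_int_diff)
  then show ?thesis
    using bspec[OF eq, of v] bspec[OF eq, of "r *s v"] assms PQ Qv by (simp add: hom_poly_scale)
qed

lemma continuous_on_affine_line: "continuous_on S (\<lambda>t. u + t *s (w :: complex ^ 'n))"
  unfolding vector_scalar_mult_def by (intro continuous_intros continuous_on_vec_lambda)

text \<open>Division by a linear form: this is where sections vanishing on a line become sections of a
  twist by \<open>-1\<close>. A numerator vanishing on the line near one of its points vanishes on the whole
  line, being polynomial on every affine line through that point.\<close>

lemma regular_divide_linear_form:
  assumes s: "regular k C s" and C: "open C" "0 \<notin> C" and "v \<in> C" and c: "c \<noteq> 0" "linear_form c v = 0"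
    and zero: "\<And>x. x \<in> C \<Longrightarrow> linear_form c x = 0 \<Longrightarrow> s x = 0"
  obtains m g s' where "hom_poly m g" "g v \<noteq> 0" "regular (k - 1) {x \<in> C. g x \<noteq> 0} s'"
    "\<And>x. x \<in> C \<Longrightarrow> g x \<noteq> 0 \<Longrightarrow> s x = linear_form c x * s' x"
proof -
  obtain P Q i j where PQ: "hom_poly i P" "hom_poly j Q" and k: "int i - int j = k" and Qv: "Q v \<noteq> 0"
    and eq: "\<forall>x\<in>C. Q x \<noteq> 0 \<longrightarrow> s x = P x / Q x"
    by (rule regularE[OF s \<open>v \<in> C\<close>]) (rule that)
  \<comment> \<open>Where \<open>s\<close> is \<open>P / Q\<close>; here vanishing of \<open>s\<close> is vanishing of \<open>P\<close>.\<close>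
  define N where "N = C \<inter> {x. Q x \<noteq> 0}"
  have "open {x. Q x \<noteq> 0}"
    using continuous_hom_poly[OF PQ(2)] by (auto intro!: open_Collect_neq)
  then have N: "open N" "v \<in> N"
    using C(1) \<open>v \<in> C\<close> Qv by (auto simp: N_def)
  have "P x = 0" if x: "linear_form c x = 0" for x
  proof -
    obtain p where p: "\<And>t. P (v + t *s (x - v)) = poly p t"
      using hom_poly_on_line[OF PQ(1)] by blast
    have "continuous_on UNIV (\<lambda>t. v + t *s (x - v))"
      by (rule continuous_on_affine_line)
    then have "open ((\<lambda>t. v + t *s (x - v)) -` N)"
      using N(1) by (simp add: continuous_open_vimage continuous_on_eq_continuous_at)
    moreover have "0 \<in> (\<lambda>t. v + t *s (x - v)) -` N"
      using N(2) by simp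
    ultimately have "infinite ((\<lambda>t. v + t *s (x - v)) -` N)"
      using finite_imp_not_open by blast
    moreover have "poly p t = 0" if "t \<in> (\<lambda>t. v + t *s (x - v)) -` N" for t
      using that bspec[OF eq, of "v + t *s (x - v)"] zero[of "v + t *s (x - v)"] c(2) x
      unfolding p[symmetric] by (auto simp: N_def linear_form_simps)
    ultimately have "p = 0"
      using poly_roots_finite[of p] finite_subset[of _ "{t. poly p t = 0}"] by blast
    then show ?thesis using p[of 1] by simp
  qed
  then obtain P' where P': "\<And>x. P x = linear_form c x * P' x"
    and deg: "if i = 0 then P' = (\<lambda>_. 0) else hom_poly (i - 1) P'"
    using linear_form_dvd[OF PQ(1) c(1)] by metis
  have "regular (k - 1) {x \<in> C. Q x \<noteq> 0} (\<lambda>x. P' x / Q x)"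
  proof (cases "i = 0")
    case True
    then show ?thesis using deg C(2) by (auto intro: regular_zero)
  next
    case False
    then show ?thesis using deg k PQ(2) by (auto intro!: regular_quotientI[of "i - 1" P' j Q])
  qed
  then show thesis
    using PQ Qv eq P' by (intro that[of j Q "\<lambda>x. P' x / Q x"]) auto
qed

section \<open>Sections of sums of line bundles\<close>

lemma twist_sections_iff:
  assumes U: "zariski_open U"
  shows "s \<in> twist_sections k U \<longleftrightarrow> (\<forall>v. v \<notin> cone U \<longrightarrow> s v = 0) \<and> regular k (cone U) s"
proof
  assume s: "s \<in> twist_sections k U"
  have "regular k (cone U) s"
  proof (rule regular_local)
    fix v assume v: "v \<in> cone U"
    then have "vec.span {v} \<in> U" by (simp add: cone_def)
    then obtain V P Q i j where V: "zariski_open V" "vec.span {v} \<in> V"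
      and PQ: "hom_poly i P" "hom_poly j Q" "int i - int j = k"
      and eq: "\<forall>x\<in>cone V. Q x \<noteq> 0 \<and> s x = P x / Q x"
      using s unfolding twist_sections_def by blast
    obtain G where G: "\<And>g. g \<in> G \<Longrightarrow> \<exists>m. hom_poly m g" and cV: "cone V = {v. v \<noteq> 0 \<and> (\<exists>g\<in>G. g v \<noteq> 0)}"
      using zariski_open_cone[OF V(1)] by blast
    have "v \<in> cone V" using v V(2) by (simp add: cone_def)
    then obtain g m where g: "g \<in> G" "g v \<noteq> 0" "hom_poly m g" using cV G by blast
    have "{x \<in> cone U. g x \<noteq> 0} \<subseteq> cone V"
      using g(1) zero_notin_cone[of U] unfolding cV by blast
    then have "regular k {x \<in> cone U. g x \<noteq> 0} s"
      using eq PQ by (intro regular_quotientI[of i P j Q]) auto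
    then show "\<exists>m g. hom_poly m g \<and> g v \<noteq> 0 \<and> regular k {x \<in> cone U. g x \<noteq> 0} s"
      using g by blast
  qed
  then show "(\<forall>v. v \<notin> cone U \<longrightarrow> s v = 0) \<and> regular k (cone U) s"
    using s unfolding twist_sections_def by blast
next
  assume s: "(\<forall>v. v \<notin> cone U \<longrightarrow> s v = 0) \<and> regular k (cone U) s"
  have "\<exists>V P Q i j. zariski_open V \<and> p \<in> V \<and> V \<subseteq> U \<and>
            hom_poly i P \<and> hom_poly j Q \<and> int i - int j = k \<and>
            (\<forall>v\<in>cone V. Q v \<noteq> 0 \<and> s v = P v / Q v)" if "p \<in> U" for p
  proof -
    obtain v where v: "v \<in> cone U" "p = vec.span {v}"
      using zariski_open_point[OF U \<open>p \<in> U\<close>] .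
    have "regular k (cone U) s" using s by blast
    then obtain P Q i j where PQ: "hom_poly i P" "hom_poly j Q" "int i - int j = k" "Q v \<noteq> 0"
      "\<forall>x\<in>cone U. Q x \<noteq> 0 \<longrightarrow> s x = P x / Q x"
      by (rule regularE[OF _ v(1)]) (rule that)
    have "v \<in> cone (nonvanishing Q)"
      using v(1) PQ(4) zero_notin_cone[of U] unfolding cone_nonvanishing[OF PQ(2)] by blast
    then have "p \<in> U \<inter> nonvanishing Q"
      using v \<open>p \<in> U\<close> by (auto simp: cone_def)
    then show ?thesis
      using PQ zariski_open_Int[OF U zariski_open_nonvanishing[OF PQ(2)]]
      by (intro exI[of _ "U \<inter> nonvanishing Q"] exI[of _ P] exI[of _ Q] exI[of _ i] exI[of _ j])
        (auto simp: cone_Int cone_nonvanishing[OF PQ(2)])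
  qed
  then show "s \<in> twist_sections k U"
    using s unfolding twist_sections_def by blast
qed

lemma twist_sum_iff:
  assumes U: "zariski_open U"
  shows "s \<in> twist_sum k U \<longleftrightarrow>
    (\<forall>v. v \<notin> cone U \<longrightarrow> s v = 0) \<and> (\<forall>i. regular (k $ i) (cone U) (\<lambda>v. s v $ i))"
  unfolding twist_sum_def using twist_sections_iff[OF U] by (auto simp: vec_eq_iff)

lemma restr_in_twist_sum:
  assumes "zariski_open U" "\<And>i. regular (k $ i) (cone U) (\<lambda>v. s v $ i)"
  shows "restr U s \<in> twist_sum k U"
  unfolding twist_sum_iff[OF assms(1)]
  using regular_cong[OF assms(2)] by (simp add: restr_def)

lemma restr_twist_sum:
  assumes "zariski_open U" "s \<in> twist_sum k U"
  shows "restr U s = s"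
  using assms(2) unfolding twist_sum_iff[OF assms(1)] restr_def by auto

text \<open>Evaluating a morphism on the local generators \<open>v \<mapsto> v\<^sub>l\<^sup>k\<close> of each summand, which exist where
  the coordinate \<open>v\<^sub>l\<close> does not vanish, and rescaling gives columns that agree on overlaps by
  linearity. So a morphism of sums of line bundles is a matrix of global regular functions.\<close>

lemma sheaf_morphism_matrix:
  fixes k :: "int ^ 'r::finite" and m :: "int ^ 'q::finite"
  assumes mor: "sheaf_morphism (twist_sum k) G \<phi>"
    and G: "\<And>U. zariski_open U \<Longrightarrow> G U \<subseteq> twist_sum m U"
  obtains M :: "'r \<Rightarrow> complex ^ 3 \<Rightarrow> complex ^ 'q" where
    "\<And>i j. regular (m $ j - k $ i) (- {0}) (\<lambda>v. M i v $ j)"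
    "\<And>U s v. zariski_open U \<Longrightarrow> s \<in> twist_sum k U \<Longrightarrow> v \<in> cone U \<Longrightarrow>
      \<phi> U s v = (\<Sum>i\<in>UNIV. s v $ i *s M i v)"
proof -
  have im: "\<phi> U s \<in> G U"
    and additive: "\<lbrakk>s \<in> twist_sum k U; t \<in> twist_sum k U\<rbrakk> \<Longrightarrow>
      \<phi> U (\<lambda>v. s v + t v) = (\<lambda>v. \<phi> U s v + \<phi> U t v)"
    and linear: "\<lbrakk>g \<in> twist_sections 0 U; s \<in> twist_sum k U\<rbrakk> \<Longrightarrow> \<phi> U (\<lambda>v. g v *s s v) = (\<lambda>v. g v *s \<phi> U s v)"
    and natural: "\<lbrakk>zariski_open V; V \<subseteq> U; s \<in> twist_sum k U\<rbrakk> \<Longrightarrow> \<phi> V (restr V s) = restr V (\<phi> U s)"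
    if "zariski_open U" "s \<in> twist_sum k U" for U V s t g
    using mor that unfolding sheaf_morphism_def by blast+
  define D :: "3 \<Rightarrow> point set" where "D l = nonvanishing (\<lambda>v. v $ l)" for l
  have openD: "zariski_open (D l)" for l
    unfolding D_def by (rule zariski_open_nonvanishing[OF hom_poly_coord])
  have coneD: "cone (D l) = {v. v $ l \<noteq> 0}" for l
    unfolding D_def cone_nonvanishing[OF hom_poly_coord] by auto
  define e :: "3 \<Rightarrow> 'r \<Rightarrow> 'r sect" where "e l i = restr (D l) (\<lambda>v. (v $ l) powi (k $ i) *s axis i 1)" for l i
  have e: "e l i \<in> twist_sum k (D l)" for l i
    unfolding e_def
  proof (rule restr_in_twist_sum[OF openD])
    fix j
    have "regular (k $ i) (cone (D l)) (\<lambda>v. (v $ l) powi (k $ i))"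
      by (rule regular_power_int[OF hom_poly_coord]) (simp add: coneD)
    then show "regular (k $ j) (cone (D l)) (\<lambda>v. ((v $ l) powi (k $ i) *s axis i 1) $ j)"
      using regular_zero[of "cone (D l)" "k $ j"] zero_notin_cone by (cases "i = j") (auto simp: axis_def)
  qed
  define E where "E l i = \<phi> (D l) (e l i)" for l i
  have E: "E l i \<in> twist_sum m (D l)" for l i
    unfolding E_def using im[OF openD e] G[OF openD] by blast
  have key: "\<phi> U s v = (\<Sum>i\<in>UNIV. (s v $ i * (v $ l) powi (- (k $ i))) *s E l i v)"
    if U: "zariski_open U" and s: "s \<in> twist_sum k U" and v: "v \<in> cone U" and l: "v $ l \<noteq> 0" for U s v l
  proof -
    define W where "W = U \<inter> D l"
    have W: "zariski_open W" "W \<subseteq> U" "W \<subseteq> D l"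
      unfolding W_def using zariski_open_Int[OF U openD] by auto
    have coneW: "cone W = cone U \<inter> {v. v $ l \<noteq> 0}"
      unfolding W_def cone_Int coneD ..
    define g where "g i = (\<lambda>x. if x \<in> cone W then s x $ i * (x $ l) powi (- (k $ i)) else 0)" for i
    have sreg: "regular (k $ i) (cone W) (\<lambda>x. s x $ i)" for i
      using s[unfolded twist_sum_iff[OF U]] coneW by (blast intro: regular_subset)
    have "regular 0 (cone W) (\<lambda>x. s x $ i * (x $ l) powi (- (k $ i)))" for i
      using regular_mult[OF sreg regular_power_int[OF hom_poly_coord[of l]], of i "- (k $ i)"] coneW by auto
    then have g: "g i \<in> twist_sections 0 W" for i
      unfolding twist_sections_iff[OF W(1)] g_def
      by (intro conjI allI impI) (simp, erule meta_allE[of _ i], rule regular_cong, auto)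
    have eW: "restr W (e l i) \<in> twist_sum k W" for i
    proof (rule restr_in_twist_sum[OF W(1)])
      show "regular (k $ j) (cone W) (\<lambda>v. e l i v $ j)" for j
        using e[of l i, unfolded twist_sum_iff[OF openD]] coneW coneD by (blast intro: regular_subset)
    qed
    have "(\<lambda>x. g i x *s restr W (e l i) x) \<in> twist_sum k W" for i
      unfolding twist_sum_iff[OF W(1)]
    proof (intro conjI allI impI)
      show "g i v *s restr W (e l i) v = 0" if "v \<notin> cone W" for v
        using that by (simp add: g_def)
      show "regular (k $ j) (cone W) (\<lambda>v. (g i v *s restr W (e l i) v) $ j)" for j
        using regular_mult[of 0 "cone W" "g i" "k $ j" "\<lambda>v. restr W (e l i) v $ j"]
          g[of i, unfolded twist_sections_iff[OF W(1)]] eW[of i, unfolded twist_sum_iff[OF W(1)]] by simp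
    qed
    note summand = this
    have zero: "(\<lambda>x. 0) \<in> twist_sum k W"
      unfolding twist_sum_iff[OF W(1)] using regular_zero[OF zero_notin_cone] by auto
    have zero': "(\<lambda>x. 0) \<in> twist_sections 0 W"
      unfolding twist_sections_iff[OF W(1)] using regular_zero[OF zero_notin_cone] by auto
    have sums: "(\<lambda>x. \<Sum>i\<in>I. g i x *s restr W (e l i) x) \<in> twist_sum k W \<and>
        \<phi> W (\<lambda>x. \<Sum>i\<in>I. g i x *s restr W (e l i) x) = (\<lambda>x. \<Sum>i\<in>I. g i x *s restr W (E l i) x)"
      if "finite I" for I
      using that
    proof (induction I rule: finite_induct)
      case empty
      show ?case using linear[OF W(1) zero zero' zero] zero by simp
    next
      case (insert i I)
      have "\<phi> W (\<lambda>x. g i x *s restr W (e l i) x) = (\<lambda>x. g i x *s restr W (E l i) x)"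
        using linear[OF W(1) eW g eW] natural[OF openD e W(1) W(3) e] by (simp add: E_def)
      moreover have "(\<lambda>x. g i x *s restr W (e l i) x + (\<Sum>i\<in>I. g i x *s restr W (e l i) x)) \<in> twist_sum k W"
        using insert.IH summand[of i] unfolding twist_sum_iff[OF W(1)]
        by (auto intro: regular_add simp: vec_eq_iff)
      ultimately show ?case
        using insert additive[OF W(1) summand[of i] summand[of i] , of "\<lambda>x. \<Sum>i\<in>I. g i x *s restr W (e l i) x"]
        by simp
    qed
    have "restr W s = (\<lambda>x. \<Sum>i\<in>UNIV. g i x *s restr W (e l i) x)"
    proof
      fix x
      show "restr W s x = (\<Sum>i\<in>UNIV. g i x *s restr W (e l i) x)"
      proof (cases "x \<in> cone W")
        case True
        then have x: "x $ l \<noteq> 0" "x \<in> cone (D l)" by (auto simp: coneW coneD)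
        have "(\<Sum>i\<in>UNIV. g i x *s restr W (e l i) x) = (\<Sum>i\<in>UNIV. s x $ i *s axis i 1)"
          using True x by (intro sum.cong) (auto simp: g_def restr_def e_def power_int_minus)
        then show ?thesis
          using True by (simp add: restr_def basis_expansion)
      qed (simp add: restr_def g_def)
    qed
    then have "restr W (\<phi> U s) = (\<lambda>x. \<Sum>i\<in>UNIV. g i x *s restr W (E l i) x)"
      using natural[OF U s W(1) W(2) s] sums[of UNIV] by simp
    then have "restr W (\<phi> U s) v = (\<Sum>i\<in>UNIV. g i v *s restr W (E l i) v)"
      by simp
    moreover have "v \<in> cone W" using v l by (simp add: coneW)
    ultimately show ?thesis
      by (simp add: restr_def g_def)
  qed
  define lc where "lc v = (SOME l. v $ l \<noteq> 0)" for v :: "complex ^ 3"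
  have lc: "v $ lc v \<noteq> 0" if "v \<noteq> 0" for v
    using exists_coord_nonzero[OF that] unfolding lc_def by (rule someI_ex)
  define M where "M i v = (v $ lc v) powi (- (k $ i)) *s E (lc v) i v" for i v
  have formula: "\<phi> U s v = (\<Sum>i\<in>UNIV. s v $ i *s M i v)"
    if U: "zariski_open U" and s: "s \<in> twist_sum k U" and v: "v \<in> cone U" for U s v
    using key[OF U s v lc[of v]] v zero_notin_cone[of U] unfolding M_def by auto
  have E_M: "E l i x = (x $ l) powi (k $ i) *s M i x" if "x $ l \<noteq> 0" for l i x
  proof -
    have "E l i x = (\<Sum>j\<in>UNIV. e l i x $ j *s M j x)"
      unfolding E_def using that by (intro formula[OF openD e]) (simp add: coneD)
    also have "\<dots> = (\<Sum>j\<in>UNIV. if j = i then (x $ l) powi (k $ i) *s M i x else 0)"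
      using that by (intro sum.cong) (auto simp: e_def restr_def coneD axis_def)
    finally show ?thesis by simp
  qed
  have "regular (m $ j - k $ i) (- {0}) (\<lambda>v. M i v $ j)" for i j
  proof (rule regular_local)
    fix v :: "complex ^ 3" assume "v \<in> - {0}"
    then obtain l where l: "v $ l \<noteq> 0" using exists_coord_nonzero by auto
    have C: "{x \<in> - {0}. x $ l \<noteq> 0} = cone (D l)"
      by (auto simp: coneD)
    have "regular (m $ j) (cone (D l)) (\<lambda>x. E l i x $ j)"
      using E[of l i, unfolded twist_sum_iff[OF openD]] by blast
    from regular_mult[OF this regular_power_int[OF hom_poly_coord[of l]], of "- (k $ i)"]
    have "regular (m $ j - k $ i) (cone (D l)) (\<lambda>x. E l i x $ j * (x $ l) powi (- (k $ i)))"
      by (simp add: coneD)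
    then have "regular (m $ j - k $ i) (cone (D l)) (\<lambda>x. M i x $ j)"
      by (rule regular_cong) (auto simp: coneD E_M power_int_minus)
    then show "\<exists>n g. hom_poly n g \<and> g v \<noteq> 0 \<and> regular (m $ j - k $ i) {x \<in> - {0}. g x \<noteq> 0} (\<lambda>v. M i v $ j)"
      using l hom_poly_coord[of l] C by (intro exI[of _ 1] exI[of _ "\<lambda>x. x $ l"]) auto
  qed
  then show thesis
    using formula by (rule that)
qed

text \<open>Exactness in terms of the two matrices: \<open>L\<close> is a single column with \<open>\<Theta>\<close> vanishing on it, it is
  nonzero by injectivity, every local relation among the columns \<open>\<Theta> i\<close> is a multiple of \<open>L\<close>, and the
  \<open>\<Theta> i\<close> generate \<open>G\<close> locally.\<close>

lemma short_exact_matrices: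
  fixes k m :: "int ^ 3"
  assumes exact: "short_exact (twist_sum (vector [e] :: int ^ 1)) \<phi> (twist_sum k) \<psi> G"
    and G: "\<And>U. zariski_open U \<Longrightarrow> G U \<subseteq> twist_sum m U"
  obtains L :: "complex ^ 3 \<Rightarrow> complex ^ 3" and \<Theta> :: "3 \<Rightarrow> complex ^ 3 \<Rightarrow> complex ^ 3" where
    "\<And>i. regular (k $ i - e) (- {0}) (\<lambda>v. L v $ i)"
    "\<And>i j. regular (m $ j - k $ i) (- {0}) (\<lambda>v. \<Theta> i v $ j)"
    "\<exists>v. v \<noteq> 0 \<and> L v \<noteq> 0"
    "\<And>v. v \<noteq> 0 \<Longrightarrow> (\<Sum>i\<in>UNIV. L v $ i *s \<Theta> i v) = 0"
    "\<And>U s. zariski_open U \<Longrightarrow> (\<And>i. regular (k $ i) (cone U) (\<lambda>x. s x $ i)) \<Longrightarrow>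
      restr U (\<lambda>x. \<Sum>i\<in>UNIV. s x $ i *s \<Theta> i x) \<in> G U"
    "\<And>U s v. zariski_open U \<Longrightarrow> (\<And>i. regular (k $ i) (cone U) (\<lambda>x. s x $ i)) \<Longrightarrow>
      (\<And>x. x \<in> cone U \<Longrightarrow> (\<Sum>i\<in>UNIV. s x $ i *s \<Theta> i x) = 0) \<Longrightarrow> v \<in> cone U \<Longrightarrow>
      \<exists>V g. zariski_open V \<and> v \<in> cone V \<and> cone V \<subseteq> cone U \<and> regular e (cone V) g \<and>
        (\<forall>x\<in>cone V. s x = g x *s L x)"
    "\<And>U t v. zariski_open U \<Longrightarrow> t \<in> G U \<Longrightarrow> v \<in> cone U \<Longrightarrow>
      \<exists>V s. zariski_open V \<and> v \<in> cone V \<and> cone V \<subseteq> cone U \<and>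
        (\<forall>i. regular (k $ i) (cone V) (\<lambda>x. s x $ i)) \<and> (\<forall>x\<in>cone V. t x = (\<Sum>i\<in>UNIV. s x $ i *s \<Theta> i x))"
proof -
  let ?E = "twist_sum (vector [e] :: int ^ 1)" and ?F = "twist_sum k"
  have mor: "sheaf_morphism ?E ?F \<phi>" "sheaf_morphism ?F G \<psi>"
    and ker: "\<And>U. zariski_open U \<Longrightarrow> kernel_sheaf ?E \<phi> U = {\<lambda>_. 0}"
    and mid: "\<And>U. zariski_open U \<Longrightarrow> image_sheaf ?E ?F \<phi> U = kernel_sheaf ?F \<psi> U"
    and surj: "\<And>U. zariski_open U \<Longrightarrow> image_sheaf ?F G \<psi> U = G U"
    using exact unfolding short_exact_def by auto
  obtain M where M: "\<And>i j. regular (k $ j - (vector [e] :: int ^ 1) $ i) (- {0}) (\<lambda>v. M i v $ j)"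
    and \<phi>: "\<And>U s v. zariski_open U \<Longrightarrow> s \<in> ?E U \<Longrightarrow> v \<in> cone U \<Longrightarrow>
      \<phi> U s v = (\<Sum>i\<in>UNIV. s v $ i *s M i v)"
    using sheaf_morphism_matrix[OF mor(1), of k] by blast
  obtain \<Theta> where \<Theta>: "\<And>i j. regular (m $ j - k $ i) (- {0}) (\<lambda>v. \<Theta> i v $ j)"
    and \<psi>: "\<And>U s v. zariski_open U \<Longrightarrow> s \<in> ?F U \<Longrightarrow> v \<in> cone U \<Longrightarrow>
      \<psi> U s v = (\<Sum>i\<in>UNIV. s v $ i *s \<Theta> i v)"
    using sheaf_morphism_matrix[OF mor(2) G] by blast
  define L where "L = M 1"
  have \<phi>L: "\<phi> U s v = s v $ 1 *s L v" if "zariski_open U" "s \<in> ?E U" "v \<in> cone U" for U s v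
    using \<phi>[OF that] by (simp add: L_def)
  have \<phi>F: "\<phi> U s \<in> ?F U" if "zariski_open U" "s \<in> ?E U" for U s
    using mor(1) that unfolding sheaf_morphism_def by blast
  have \<psi>G: "\<psi> U s \<in> G U" if "zariski_open U" "s \<in> ?F U" for U s
    using mor(2) that unfolding sheaf_morphism_def by blast
  have off\<psi>: "\<psi> U s v = 0" if "zariski_open U" "s \<in> ?F U" "v \<notin> cone U" for U s v
    using \<psi>G[OF that(1,2)] G[OF that(1)] that(3) twist_sum_iff[OF that(1)] by blast
  define D :: "3 \<Rightarrow> point set" where "D l = nonvanishing (\<lambda>v. v $ l)" for l
  have openD: "zariski_open (D l)" for l
    unfolding D_def by (rule zariski_open_nonvanishing[OF hom_poly_coord])
  have coneD: "cone (D l) = {v. v $ l \<noteq> 0}" for l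
    unfolding D_def cone_nonvanishing[OF hom_poly_coord] by auto
  define f :: "3 \<Rightarrow> 1 sect" where "f l = restr (D l) (\<lambda>v. vec ((v $ l) powi e))" for l
  have f: "f l \<in> ?E (D l)" for l
  proof -
    have "\<forall>i. regular ((vector [e] :: int ^ 1) $ i) (cone (D l)) (\<lambda>v. (vec ((v $ l) powi e) :: complex ^ 1) $ i)"
      unfolding forall_1 using regular_power_int[OF hom_poly_coord, of "cone (D l)" l e] by (simp add: coneD)
    then show ?thesis
      unfolding f_def by (intro restr_in_twist_sum openD) blast
  qed
  have f_at: "f l v $ 1 \<noteq> 0" if "v $ l \<noteq> 0" for l v
    using that by (simp add: f_def restr_def coneD)
  show thesis
  proof (rule that[of L \<Theta>])
    show "regular (k $ i - e) (- {0}) (\<lambda>v. L v $ i)" for i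
      using M[of i 1] by (simp add: L_def)
    show "regular (m $ j - k $ i) (- {0}) (\<lambda>v. \<Theta> i v $ j)" for i j
      by (rule \<Theta>)
    show "\<exists>v. v \<noteq> 0 \<and> L v \<noteq> 0"
    proof (rule ccontr)
      assume "\<not> ?thesis"
      then have L: "L v = 0" if "v \<noteq> 0" for v using that by blast
      have "\<phi> (D 1) (f 1) v = 0" for v
      proof (cases "v \<in> cone (D 1)")
        case True
        then show ?thesis using \<phi>L[OF openD f True] L[of v] zero_notin_cone by auto
      next
        case False
        then show ?thesis using \<phi>F[OF openD f] twist_sum_iff[OF openD] by blast
      qed
      then have "f 1 \<in> kernel_sheaf ?E \<phi> (D 1)"
        using f unfolding kernel_sheaf_def by auto
      then have "f 1 = (\<lambda>_. 0)" using ker[OF openD] by auto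
      then show False using f_at[of "axis 1 1" 1] by (simp add: axis_def)
    qed
    show "(\<Sum>i\<in>UNIV. L v $ i *s \<Theta> i v) = 0" if nz: "v \<noteq> 0" for v
    proof -
      obtain l where l: "v $ l \<noteq> 0" using exists_coord_nonzero[OF nz] by blast
      then have v: "v \<in> cone (D l)" by (simp add: coneD)
      have "\<phi> (D l) (f l) \<in> image_sheaf ?E ?F \<phi> (D l)"
        unfolding image_sheaf_def using \<phi>F[OF openD f] openD f restr_twist_sum[OF openD \<phi>F[OF openD f]] by fastforce
      then have "\<psi> (D l) (\<phi> (D l) (f l)) v = 0"
        unfolding mid[OF openD] kernel_sheaf_def by simp
      then have "(\<Sum>i\<in>UNIV. (f l v $ 1 * L v $ i) *s \<Theta> i v) = 0"
        using \<psi>[OF openD \<phi>F[OF openD f] v] \<phi>L[OF openD f v] by simp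
      then have "f l v $ 1 *s (\<Sum>i\<in>UNIV. L v $ i *s \<Theta> i v) = 0"
        by (simp add: vec.scale_sum_right)
      then show ?thesis using f_at[OF l] by simp
    qed
    show "restr U (\<lambda>x. \<Sum>i\<in>UNIV. s x $ i *s \<Theta> i x) \<in> G U"
      if U: "zariski_open U" and s: "\<And>i. regular (k $ i) (cone U) (\<lambda>x. s x $ i)" for U s
    proof -
      have rs: "restr U s \<in> ?F U" by (rule restr_in_twist_sum[OF U s])
      have "\<psi> U (restr U s) = restr U (\<lambda>x. \<Sum>i\<in>UNIV. s x $ i *s \<Theta> i x)"
      proof
        fix x
        show "\<psi> U (restr U s) x = restr U (\<lambda>x. \<Sum>i\<in>UNIV. s x $ i *s \<Theta> i x) x"
        proof (cases "x \<in> cone U")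
          case True
          then show ?thesis using \<psi>[OF U rs True] by (simp add: restr_def)
        next
          case False
          then show ?thesis using off\<psi>[OF U rs False] by (simp add: restr_def)
        qed
      qed
      then show ?thesis using \<psi>G[OF U rs] by simp
    qed
    show "\<exists>V g. zariski_open V \<and> v \<in> cone V \<and> cone V \<subseteq> cone U \<and> regular e (cone V) g \<and>
        (\<forall>x\<in>cone V. s x = g x *s L x)"
      if U: "zariski_open U" and s: "\<And>i. regular (k $ i) (cone U) (\<lambda>x. s x $ i)"
        and zero: "\<And>x. x \<in> cone U \<Longrightarrow> (\<Sum>i\<in>UNIV. s x $ i *s \<Theta> i x) = 0" and v: "v \<in> cone U" for U s v
    proof -
      have rs: "restr U s \<in> ?F U" by (rule restr_in_twist_sum[OF U s])
      have "\<psi> U (restr U s) x = 0" for x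
      proof (cases "x \<in> cone U")
        case True
        then show ?thesis using \<psi>[OF U rs True] zero[OF True] by (simp add: restr_def)
      qed (rule off\<psi>[OF U rs])
      then have "restr U s \<in> kernel_sheaf ?F \<psi> U"
        using rs unfolding kernel_sheaf_def by auto
      then have "restr U s \<in> image_sheaf ?E ?F \<phi> U"
        using mid[OF U] by simp
      moreover have "vec.span {v} \<in> U" using v by (simp add: cone_def)
      ultimately obtain V g where V: "zariski_open V" "vec.span {v} \<in> V" "V \<subseteq> U"
        and g: "g \<in> ?E V" and eq: "\<phi> V g = restr V (restr U s)"
        unfolding image_sheaf_def by blast
      have cV: "v \<in> cone V" "cone V \<subseteq> cone U"
        using V v by (auto simp: cone_def)
      have "s x = g x $ 1 *s L x" if "x \<in> cone V" for x
        using \<phi>L[OF V(1) g that] fun_cong[OF eq, of x] that cV(2) by (auto simp: restr_def)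
      moreover have "regular e (cone V) (\<lambda>x. g x $ 1)"
        using g[unfolded twist_sum_iff[OF V(1)]] by (auto simp: forall_1)
      ultimately show ?thesis using V(1) cV by blast
    qed
    show "\<exists>V s. zariski_open V \<and> v \<in> cone V \<and> cone V \<subseteq> cone U \<and>
        (\<forall>i. regular (k $ i) (cone V) (\<lambda>x. s x $ i)) \<and> (\<forall>x\<in>cone V. t x = (\<Sum>i\<in>UNIV. s x $ i *s \<Theta> i x))"
      if U: "zariski_open U" and t: "t \<in> G U" and v: "v \<in> cone U" for U t v
    proof -
      have "t \<in> image_sheaf ?F G \<psi> U" using surj[OF U] t by simp
      moreover have "vec.span {v} \<in> U" using v by (simp add: cone_def)
      ultimately obtain V s where V: "zariski_open V" "vec.span {v} \<in> V" "V \<subseteq> U"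
        and s: "s \<in> ?F V" and eq: "\<psi> V s = restr V t"
        unfolding image_sheaf_def by blast
      have cV: "v \<in> cone V" "cone V \<subseteq> cone U"
        using V v by (auto simp: cone_def)
      have "t x = (\<Sum>i\<in>UNIV. s x $ i *s \<Theta> i x)" if "x \<in> cone V" for x
        using \<psi>[OF V(1) s that] fun_cong[OF eq, of x] that by (simp add: restr_def)
      moreover have "\<forall>i. regular (k $ i) (cone V) (\<lambda>x. s x $ i)"
        using s[unfolded twist_sum_iff[OF V(1)]] by blast
      ultimately show ?thesis using V(1) cV by blast
    qed
  qed
qed

section \<open>Lines of an arrangement\<close>

lemma line_of_iff: "p \<in> line_of c \<longleftrightarrow> (\<exists>v. v \<noteq> 0 \<and> p = vec.span {v} \<and> linear_form c v = 0)"
proof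
  assume "p \<in> line_of c"
  then show "\<exists>v. v \<noteq> 0 \<and> p = vec.span {v} \<and> linear_form c v = 0"
    unfolding line_of_def P2_def using vec.span_base by blast
next
  assume "\<exists>v. v \<noteq> 0 \<and> p = vec.span {v} \<and> linear_form c v = 0"
  then show "p \<in> line_of c"
    unfolding line_of_def P2_def by (auto simp: vec.span_singleton linear_form_simps)
qed

lemma span_in_line_of_iff: "v \<noteq> 0 \<Longrightarrow> vec.span {v} \<in> line_of c \<longleftrightarrow> linear_form c v = 0"
  unfolding line_of_def P2_def using vec.span_base[of v "{v}"]
  by (auto simp: vec.span_singleton linear_form_simps)

lemma form_of:
  assumes "arrangement A" "H \<in> A"
  shows "form_of H \<noteq> 0" "line_of (form_of H) = H"
proof -
  have "\<exists>c. c \<noteq> 0 \<and> H = line_of c"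
    using assms unfolding arrangement_def by blast
  then have "form_of H \<noteq> 0 \<and> H = line_of (form_of H)"
    unfolding form_of_def by (rule someI_ex)
  then show "form_of H \<noteq> 0" "line_of (form_of H) = H" by auto
qed

abbreviation form_at :: "point set \<Rightarrow> complex ^ 3 \<Rightarrow> complex" where
  "form_at H v \<equiv> linear_form (form_of H) v"

text \<open>Coordinates on the plane over the line with form \<open>c\<close>, completing a given vector \<open>w\<close>.\<close>

locale line_basis =
  fixes c u w lu lw :: "complex ^ 3"
  assumes form_u: "linear_form c u = 0" and form_w: "linear_form c w = 0"
    and lu: "linear_form lu u = 1" "linear_form lu w = 0"
    and lw: "linear_form lw u = 0" "linear_form lw w = 1"
    and expand: "linear_form c v = 0 \<Longrightarrow> v = linear_form lu v *s u + linear_form lw v *s w"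

lemma third_index:
  assumes "i \<noteq> (k :: 3)"
  obtains j where "j \<noteq> i" "j \<noteq> k" "UNIV = {i, j, k}"
proof -
  have "card {i, k} \<noteq> card (UNIV :: 3 set)" using assms by simp
  then have "{i, k} \<noteq> UNIV" by metis
  then obtain j where j: "j \<noteq> i" "j \<noteq> k" by blast
  have "{i, j, k} = UNIV"
    using assms j by (intro card_subset_eq) auto
  then show thesis using that[of j] j by simp
qed

lemma exists_line_basis:
  assumes "c \<noteq> 0" "w \<noteq> 0" "linear_form c w = 0"
  obtains u lu lw where "line_basis c u w lu lw"
proof -
  obtain k where k: "c $ k \<noteq> 0"
    using exists_coord_nonzero[OF \<open>c \<noteq> 0\<close>] by blast
  have "\<exists>i. i \<noteq> k \<and> w $ i \<noteq> 0"
  proof (rule ccontr)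
    assume *: "\<not> ?thesis"
    then have "linear_form c w = (\<Sum>i\<in>UNIV. if i = k then c $ k * w $ k else 0)"
      unfolding linear_form_def by (intro sum.cong) auto
    with assms(3) k have "w $ k = 0" by simp
    with * have "w = 0" by (auto simp: vec_eq_iff)
    with assms(2) show False by simp
  qed
  then obtain i where i: "i \<noteq> k" "w $ i \<noteq> 0" by blast
  obtain j where j: "j \<noteq> i" "j \<noteq> k" and UNIV: "UNIV = {i, j, k}"
    using third_index[OF i(1)] .
  have lf: "linear_form a v = a $ i * v $ i + a $ j * v $ j + a $ k * v $ k" for a v
    unfolding linear_form_def UNIV using i(1) j by simp
  define u :: "complex ^ 3" where "u = axis j 1 - axis k (c $ j / c $ k)"
  define lw :: "complex ^ 3" where "lw = axis i (1 / w $ i)"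
  define lu :: "complex ^ 3" where "lu = axis j 1 - axis i (w $ j / w $ i)"
  have u: "u $ i = 0" "u $ j = 1" "u $ k = - c $ j / c $ k"
    and lw: "lw $ i = 1 / w $ i" "lw $ j = 0" "lw $ k = 0"
    and lu: "lu $ i = - w $ j / w $ i" "lu $ j = 1" "lu $ k = 0"
    using i(1) j by (auto simp: u_def lw_def lu_def axis_def)
  have cu: "linear_form c u = 0" using k by (simp add: lf u)
  have "v = linear_form lu v *s u + linear_form lw v *s w" if v: "linear_form c v = 0" for v
  proof -
    define x where "x = linear_form lu v *s u + linear_form lw v *s w"
    have ij: "x $ i = v $ i" "x $ j = v $ j"
      using i(2) by (auto simp: x_def u lf lw lu field_simps)
    have "linear_form c x = 0"
      by (simp add: x_def linear_form_simps cu assms(3))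
    then have "c $ k * x $ k = c $ k * v $ k"
      using v ij unfolding lf by (metis add_left_imp_eq)
    with k have "x $ k = v $ k" by simp
    with ij have "\<forall>t\<in>{i, j, k}. v $ t = x $ t" by simp
    then show ?thesis
      unfolding x_def[symmetric] vec_eq_iff UNIV[symmetric] by simp
  qed
  then have "line_basis c u w lu lw"
    using cu assms(3) i(2) by unfold_locales (auto simp: lf u lw lu)
  then show thesis by (rule that)
qed

context line_basis
begin

lemma line_point_nonzero: "u + t *s w \<noteq> 0"
proof
  assume "u + t *s w = 0"
  then have "linear_form lu (u + t *s w) = 0" by (simp add: linear_form_zero)
  then show False by (simp add: linear_form_simps lu)
qed

lemma w_nonzero: "w \<noteq> 0"
  using lw by (auto simp: linear_form_zero)

lemma form_line_point: "linear_form c (u + t *s w) = 0"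
  by (simp add: linear_form_simps form_u form_w)

end

lemma exists_line_vector:
  assumes "c \<noteq> (0 :: complex ^ 3)"
  obtains w where "w \<noteq> 0" "linear_form c w = 0"
proof -
  obtain k where k: "c $ k \<noteq> 0"
    using exists_coord_nonzero[OF assms] by blast
  obtain i where i: "i \<noteq> k" by (metis (full_types) zero_neq_one)
  define w :: "complex ^ 3" where "w = axis i 1 - (c $ i / c $ k) *s axis k 1"
  have "w $ i = 1" using i by (simp add: w_def axis_def)
  then have "w \<noteq> 0" by auto
  moreover have "linear_form c w = 0"
    using k by (simp add: w_def linear_form_simps linear_form_axis)
  ultimately show thesis by (rule that)
qed

lemma form_at_distinct_lines:
  assumes A: "arrangement A" "l \<in> A" "H \<in> A" "H \<noteq> l" and lb: "line_basis (form_of l) u w lu lw"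
  shows "form_at H u \<noteq> 0 \<or> form_at H w \<noteq> 0"
proof (rule ccontr)
  assume *: "\<not> ?thesis"
  interpret line_basis "form_of l" u w lu lw by (rule lb)
  obtain z where z: "form_at l z = 1"
    using exists_linear_form_eq_1[OF form_of(1)[OF A(1,2)]] .
  have H: "form_at H v = form_at H z * form_at l v" for v
  proof -
    define v' where "v' = v - form_at l v *s z"
    have "form_at l v' = 0" by (simp add: v'_def linear_form_simps z)
    from expand[OF this] have "form_at H v' = form_at H (linear_form lu v' *s u + linear_form lw v' *s w)"
      by simp
    also have "\<dots> = 0" using * by (simp add: linear_form_simps)
    finally show ?thesis by (simp add: v'_def linear_form_simps mult.commute)
  qed
  obtain y where "form_at H y = 1"
    using exists_linear_form_eq_1[OF form_of(1)[OF A(1,3)]] .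
  then have "form_at H z \<noteq> 0" using H[of y] by auto
  then have "form_at H v = 0 \<longleftrightarrow> form_at l v = 0" for v
    using H[of v] by simp
  then have "line_of (form_of H) = line_of (form_of l)"
    unfolding line_of_def by simp
  then show False using A form_of(2) by metis
qed

lemma finite_line_meets:
  assumes A: "arrangement A" and B: "B \<subseteq> A" and off: "\<And>H. H \<in> B \<Longrightarrow> form_at H u \<noteq> 0 \<or> form_at H w \<noteq> 0"
  shows "finite {t. \<exists>H\<in>B. form_at H (u + t *s w) = 0}"
proof -
  have "finite B" using A B unfolding arrangement_def by (blast intro: finite_subset)
  moreover have "finite {t. form_at H (u + t *s w) = 0}" if "H \<in> B" for H
  proof (rule finite_subset)
    show "{t. form_at H (u + t *s w) = 0} \<subseteq> {- form_at H u / form_at H w}"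
    proof
      fix t assume t: "t \<in> {t. form_at H (u + t *s w) = 0}"
      then have "form_at H u + t * form_at H w = 0" by (simp add: linear_form_simps)
      moreover from this off[OF that] have "form_at H w \<noteq> 0" by auto
      ultimately show "t \<in> {- form_at H u / form_at H w}"
        by (simp add: nonzero_eq_divide_eq add_eq_0_iff del: divide_minus_left)
    qed
  qed simp
  ultimately have "finite (\<Union>H\<in>B. {t. form_at H (u + t *s w) = 0})" by blast
  also have "(\<Union>H\<in>B. {t. form_at H (u + t *s w) = 0}) = {t. \<exists>H\<in>B. form_at H (u + t *s w) = 0}"
    by blast
  finally show ?thesis .
qed

text \<open>Such a vector serves as the point at infinity of the line, so that all intersection points have
  a finite parameter; it also gives directions in which to leave an intersection point along the
  line.\<close>

lemma exists_general_vector: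
  assumes A: "arrangement A" "l \<in> A"
  obtains w where "w \<noteq> 0" "form_at l w = 0" "\<And>H. H \<in> A - {l} \<Longrightarrow> form_at H w \<noteq> 0"
proof -
  obtain w where w: "w \<noteq> 0" "form_at l w = 0"
    using exists_line_vector[OF form_of(1)[OF A]] .
  obtain u lu lw where lb: "line_basis (form_of l) u w lu lw"
    using exists_line_basis[OF form_of(1)[OF A] w] .
  have "finite {t. \<exists>H\<in>A - {l}. form_at H (u + t *s w) = 0}"
    using form_at_distinct_lines[OF A _ _ lb] by (intro finite_line_meets[OF A(1)]) auto
  then obtain t where "t \<notin> {t. \<exists>H\<in>A - {l}. form_at H (u + t *s w) = 0}"
    using ex_new_if_finite[OF infinite_UNIV_char_0] by blast
  then show thesis
    using line_basis.line_point_nonzero[OF lb] line_basis.form_line_point[OF lb]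
    by (intro that[of "u + t *s w"]) auto
qed

lemma card_intersection_points:
  assumes A: "arrangement A" "l \<in> A" and lb: "line_basis (form_of l) u w lu lw"
    and off: "\<And>H. H \<in> A - {l} \<Longrightarrow> form_at H w \<noteq> 0"
  shows "card (intersection_points l A) = card {t. \<exists>H\<in>A - {l}. form_at H (u + t *s w) = 0}"
    (is "_ = card ?T")
proof -
  interpret line_basis "form_of l" u w lu lw by (rule lb)
  have "bij_betw (\<lambda>t. vec.span {u + t *s w}) ?T (intersection_points l A)"
    unfolding bij_betw_def
  proof
    show "inj_on (\<lambda>t. vec.span {u + t *s w}) ?T"
    proof (rule inj_onI)
      fix t t' assume "vec.span {u + t *s w} = vec.span {u + t' *s w}"
      then have "u + t *s w \<in> vec.span {u + t' *s w}"
        using vec.span_base[of "u + t *s w" "{u + t *s w}"] by simp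
      then obtain k where k: "u + t *s w = k *s (u + t' *s w)"
        by (auto simp: vec.span_singleton)
      have "linear_form lu (u + t *s w) = linear_form lu (k *s (u + t' *s w))"
        "linear_form lw (u + t *s w) = linear_form lw (k *s (u + t' *s w))"
        unfolding k by simp_all
      then show "t = t'" by (simp add: linear_form_simps lu lw)
    qed
    show "(\<lambda>t. vec.span {u + t *s w}) ` ?T = intersection_points l A"
    proof (intro equalityI subsetI)
      fix p assume "p \<in> (\<lambda>t. vec.span {u + t *s w}) ` ?T"
      then obtain t H where p: "p = vec.span {u + t *s w}" and H: "H \<in> A - {l}" "form_at H (u + t *s w) = 0"
        by blast
      have "p \<in> line_of (form_of l)" "p \<in> line_of (form_of H)"
        using H(2) form_line_point line_point_nonzero unfolding p by (simp_all add: span_in_line_of_iff)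
      then show "p \<in> intersection_points l A"
        using form_of(2)[OF A] form_of(2)[OF A(1)] H(1) unfolding intersection_points_def by auto
    next
      fix p assume "p \<in> intersection_points l A"
      then obtain H where H: "H \<in> A - {l}" and p: "p \<in> line_of (form_of l)" "p \<in> line_of (form_of H)"
        using form_of(2)[OF A] form_of(2)[OF A(1)] unfolding intersection_points_def by auto
      obtain v where v: "v \<noteq> 0" "p = vec.span {v}" "form_at l v = 0"
        using p(1) line_of_iff by blast
      have Hv: "form_at H v = 0"
        using p(2) v span_in_line_of_iff by blast
      define x y where "x = linear_form lu v" and "y = linear_form lw v"
      have vxy: "v = x *s u + y *s w" using expand[OF v(3)] by (simp add: x_def y_def)
      have "x \<noteq> 0"
      proof
        assume "x = 0"
        with Hv have "y * form_at H w = 0" unfolding vxy by (simp add: linear_form_simps)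
        with off[OF H] v(1) \<open>x = 0\<close> show False unfolding vxy by simp
      qed
      then have v': "v = x *s (u + (y / x) *s w)"
        unfolding vxy by (simp add: vec.scale_right_distrib)
      have "form_at H (u + (y / x) *s w) = 0"
        using Hv \<open>x \<noteq> 0\<close> by (metis v' linear_form_scale mult_eq_0_iff)
      moreover have "p = vec.span {u + (y / x) *s w}"
      proof -
        have "vec.span {v} = vec.span {u + (y / x) *s w}"
        proof (intro equalityI vec.span_minimal vec.subspace_span)
          have "x *s (u + (y / x) *s w) \<in> vec.span {u + (y / x) *s w}"
            by (intro vec.span_scale vec.span_base) simp
          then show "{v} \<subseteq> vec.span {u + (y / x) *s w}"
            using v' by simp
          have "(1 / x) *s v \<in> vec.span {v}"
            by (intro vec.span_scale vec.span_base) simp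
          moreover have "u + (y / x) *s w = (1 / x) *s v"
            using \<open>x \<noteq> 0\<close> by (subst v') simp
          ultimately show "{u + (y / x) *s w} \<subseteq> vec.span {v}"
            by simp
        qed
        then show ?thesis using v(2) by simp
      qed
      ultimately show "p \<in> (\<lambda>t. vec.span {u + t *s w}) ` ?T"
        using H by blast
    qed
  qed
  then show ?thesis by (simp add: bij_betw_same_card)
qed


section \<open>Vector fields annihilating the defining polynomial\<close>

text \<open>The derivative of the defining polynomial at \<open>v\<close> in direction \<open>y\<close>, by the product rule.\<close>

definition arrangement_deriv :: "point set set \<Rightarrow> complex ^ 3 \<Rightarrow> complex ^ 3 \<Rightarrow> complex" where
  "arrangement_deriv A v y = (\<Sum>H\<in>A. form_at H y * (\<Prod>K\<in>A - {H}. form_at K v))"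

lemma arrangement_deriv_scale: "arrangement_deriv A v (r *s y) = r * arrangement_deriv A v y"
  unfolding arrangement_deriv_def sum_distrib_left by (simp add: linear_form_scale mult.assoc)

lemma partial_deriv_defining_poly:
  assumes "finite A"
  shows "partial_deriv i (defining_poly A) v = arrangement_deriv A v (axis i 1)"
proof -
  have eq: "defining_poly A (v + t *s axis i 1) = (\<Prod>H\<in>A. form_at H v + t * form_of H $ i)" for t
    unfolding defining_poly_def by (simp add: linear_form_simps linear_form_axis)
  have d: "((\<lambda>t. form_at H v + t * form_of H $ i) has_field_derivative form_of H $ i) (at 0)" for H
    by (auto intro!: derivative_eq_intros)
  have "((\<lambda>t. \<Prod>H\<in>A. form_at H v + t * form_of H $ i) has_field_derivative
      (\<Sum>H\<in>A. form_of H $ i * (\<Prod>K\<in>A - {H}. form_at K v + 0 * form_of K $ i))) (at 0)"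
    by (rule has_field_derivative_prod) (rule d)
  then have "deriv (\<lambda>t. defining_poly A (v + t *s axis i 1)) 0 =
      (\<Sum>H\<in>A. form_of H $ i * (\<Prod>K\<in>A - {H}. form_at K v))"
    unfolding eq by (intro DERIV_imp_deriv) simp
  then show ?thesis
    unfolding partial_deriv_def arrangement_deriv_def linear_form_axis .
qed

lemma gradient_defining_poly:
  assumes "finite A"
  shows "(\<Sum>i\<in>UNIV. partial_deriv i (defining_poly A) v * y $ i) = arrangement_deriv A v y"
proof -
  have "(\<Sum>i\<in>UNIV. arrangement_deriv A v (axis i 1) * y $ i)
      = (\<Sum>i\<in>UNIV. \<Sum>H\<in>A. form_of H $ i * y $ i * (\<Prod>K\<in>A - {H}. form_at K v))"
    unfolding arrangement_deriv_def linear_form_axis sum_distrib_right by (simp add: mult_ac)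
  also have "\<dots> = (\<Sum>H\<in>A. \<Sum>i\<in>UNIV. form_of H $ i * y $ i * (\<Prod>K\<in>A - {H}. form_at K v))"
    by (rule sum.swap)
  also have "\<dots> = arrangement_deriv A v y"
    unfolding arrangement_deriv_def linear_form_def[of _ y] sum_distrib_right ..
  finally show ?thesis
    unfolding partial_deriv_defining_poly[OF assms] .
qed

lemma arrangement_bundle_iff:
  assumes "arrangement A" and U: "zariski_open U"
  shows "s \<in> arrangement_bundle A U \<longleftrightarrow> s \<in> twist_sum 0 U \<and> (\<forall>v\<in>cone U. arrangement_deriv A v (s v) = 0)"
proof -
  have fin: "finite A" using assms(1) by (simp add: arrangement_def)
  have "arrangement_deriv A v 0 = 0" for v
    by (simp add: arrangement_deriv_def linear_form_zero)
  then show ?thesis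
    unfolding arrangement_bundle_def kernel_sheaf_def gradient_map_def gradient_defining_poly[OF fin]
      twist_sum_iff[OF U]
    by (auto simp: fun_eq_iff vec_eq_iff[where 'b = 1] forall_1)
qed

lemma eventually_at_notin_finite:
  assumes "finite (S :: complex set)"
  shows "\<forall>\<^sub>F t in at a. t \<notin> S"
proof -
  have "open (- (S - {a}))"
    using assms by (intro open_Compl finite_imp_closed finite_Diff)
  then show ?thesis
    unfolding eventually_at_topological by (intro exI[of _ "- (S - {a})"]) auto
qed

lemma isCont_affine_line: "isCont (\<lambda>t. u + t *s (w :: complex ^ 'n)) (a :: complex)"
  using continuous_on_affine_line[of UNIV u w] by (simp add: continuous_on_eq_continuous_at)

lemma isCont_linear_form: "isCont (linear_form c) v"
  by (rule isCont_hom_poly[OF hom_poly_linear_form])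

lemma isCont_eq_limit:
  fixes f :: "complex \<Rightarrow> complex" and a :: complex
  assumes "isCont f a" "isCont g a" "\<forall>\<^sub>F t in at a. f t = g t"
  shows "f a = g a"
proof -
  have "(f \<longlongrightarrow> f a) (at a)" "(g \<longlongrightarrow> g a) (at a)"
    using assms(1,2) by (auto simp: isCont_def)
  moreover have "(f \<longlongrightarrow> g a) (at a)"
    using tendsto_cong[OF assms(3)] \<open>(g \<longlongrightarrow> g a) (at a)\<close> by blast
  ultimately show ?thesis using LIM_unique by blast
qed

text \<open>A field annihilating the defining polynomial is tangent to every line: on the line only one
  term of the derivative survives, and its cofactor is nonzero off the other lines. The remaining
  points of the line are reached by continuity.\<close>

lemma annihilating_field_tangent:
  assumes A: "arrangement A" "H \<in> A" and N: "open N" "v \<in> N" and H: "form_at H v = 0"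
    and ann: "\<And>x. x \<in> N \<Longrightarrow> arrangement_deriv A x (\<theta> x) = 0"
    and cont: "\<And>i. isCont (\<lambda>x. \<theta> x $ i) v"
  shows "form_at H (\<theta> v) = 0"
proof -
  obtain w where w: "form_at H w = 0" "\<And>K. K \<in> A - {H} \<Longrightarrow> form_at K w \<noteq> 0"
    using exists_general_vector[OF A] by metis
  define x where "x t = v + t *s w" for t
  have fin: "finite A" using A(1) by (simp add: arrangement_def)
  have "isCont \<theta> v"
    unfolding isCont_def by (rule vec_tendstoI) (use cont in \<open>simp add: isCont_def\<close>)
  then have "isCont (\<lambda>t. \<theta> (x t)) 0"
    using isCont_o2[of 0 x \<theta>] isCont_affine_line[where u = v and w = w and a = 0] by (simp add: x_def[abs_def])
  then have c: "isCont (\<lambda>t. form_at H (\<theta> (x t))) 0"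
    using isCont_o2[of 0 "\<lambda>t. \<theta> (x t)" "linear_form (form_of H)"] isCont_linear_form by blast
  have "open (x -` N)"
    unfolding x_def by (intro continuous_open_vimage N isCont_affine_line)
  moreover have "0 \<in> x -` N" using N by (simp add: x_def)
  ultimately have "\<forall>\<^sub>F t in at 0. t \<in> x -` N"
    by (rule eventually_at_in_open')
  moreover have "\<forall>\<^sub>F t in at 0. t \<notin> {t. \<exists>K\<in>A - {H}. form_at K (x t) = 0}"
    unfolding x_def by (intro eventually_at_notin_finite finite_line_meets[OF A(1)]) (use w in auto)
  ultimately have "\<forall>\<^sub>F t in at 0. form_at H (\<theta> (x t)) = 0"
  proof eventually_elim
    case (elim t)
    have on: "form_at H (x t) = 0" by (simp add: x_def linear_form_simps H w)
    have other: "(\<Prod>K\<in>A - {K'}. form_at K (x t)) = 0" if "K' \<in> A - {H}" for K'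
      using on A(2) that fin by (intro prod_zero) auto
    have "arrangement_deriv A (x t) (\<theta> (x t)) = form_at H (\<theta> (x t)) * (\<Prod>K\<in>A - {H}. form_at K (x t))"
      unfolding arrangement_deriv_def sum.remove[OF fin A(2)] using other by simp
    moreover have "(\<Prod>K\<in>A - {H}. form_at K (x t)) \<noteq> 0"
      using elim fin by (subst prod_zero_iff) auto
    ultimately show ?case using ann[of "x t"] elim by simp
  qed
  then have "form_at H (\<theta> (x 0)) = 0"
    using isCont_eq_limit[OF c, of "\<lambda>_. 0"] by simp
  then show ?thesis by (simp add: x_def)
qed

lemma hom_poly_prod:
  assumes "finite I" "\<And>i. i \<in> I \<Longrightarrow> hom_poly 1 (g i)"
  shows "hom_poly (card I) (\<lambda>v. \<Prod>i\<in>I. g i v)"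
  using assms
proof (induction I rule: finite_induct)
  case empty
  then show ?case by (simp add: hom_poly_const)
next
  case (insert i I)
  then show ?case using hom_poly_mult[of 1 "g i" "card I" "\<lambda>v. \<Prod>i\<in>I. g i v"] by simp
qed

text \<open>The constant field \<open>y\<close>, corrected by a multiple of the Euler field \<open>x \<mapsto> x\<close>. As the Euler
  field multiplies the defining polynomial \<open>f\<close> by its degree, the correction cancels \<open>y(f) / f\<close>,
  whose poles are the lines not containing \<open>y\<close>.\<close>

definition constant_field :: "point set set \<Rightarrow> complex ^ 3 \<Rightarrow> complex ^ 3 \<Rightarrow> complex ^ 3" where
  "constant_field A y x =
     y - ((\<Sum>K\<in>{K \<in> A. form_at K y \<noteq> 0}. form_at K y / form_at K x) / of_nat (card A)) *s x"

lemma constant_field_section: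
  assumes A: "arrangement A" "A \<noteq> {}"
  obtains U where "zariski_open U" "cone U = {x. x \<noteq> 0 \<and> (\<forall>K\<in>A. form_at K y \<noteq> 0 \<longrightarrow> form_at K x \<noteq> 0)}"
    "restr U (constant_field A y) \<in> arrangement_bundle A U"
proof -
  have fin: "finite A" using A(1) by (simp add: arrangement_def)
  define B where "B = {K \<in> A. form_at K y \<noteq> 0}"
  have B: "finite B" "B \<subseteq> A" using fin by (auto simp: B_def)
  define g where "g x = (\<Prod>K\<in>B. form_at K x)" for x
  have g: "hom_poly (card B) g"
    unfolding g_def[abs_def] by (intro hom_poly_prod B hom_poly_linear_form)
  define U where "U = nonvanishing g"
  have U: "zariski_open U" unfolding U_def by (rule zariski_open_nonvanishing[OF g])
  have "g x \<noteq> 0 \<longleftrightarrow> (\<forall>K\<in>A. form_at K y \<noteq> 0 \<longrightarrow> form_at K x \<noteq> 0)" for x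
    using B(1) by (auto simp: g_def B_def)
  then have coneU: "cone U = {x. x \<noteq> 0 \<and> (\<forall>K\<in>A. form_at K y \<noteq> 0 \<longrightarrow> form_at K x \<noteq> 0)}"
    unfolding U_def cone_nonvanishing[OF g] by auto
  have K: "form_at K x \<noteq> 0" if "K \<in> B" "x \<in> cone U" for K x
    using that by (auto simp: coneU B_def)
  define r where "r x = (\<Sum>K\<in>B. form_at K y / form_at K x)" for x
  have cf: "constant_field A y x = y - (r x / of_nat (card A)) *s x" for x
    unfolding constant_field_def r_def B_def ..
  have r: "regular (- 1) (cone U) r"
    unfolding r_def[abs_def]
    using K by (intro regular_sum B zero_notin_cone regular_quotientI[OF hom_poly_const hom_poly_linear_form]) auto
  have "restr U (constant_field A y) \<in> twist_sum 0 U"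
  proof (rule restr_in_twist_sum[OF U])
    fix i
    have "regular 0 (cone U) (\<lambda>x. y $ i - 1 / of_nat (card A) * (r x * x $ i))"
      using regular_mult[OF r regular_hom_poly[OF hom_poly_coord], of i]
      by (intro regular_diff regular_const regular_cmult) simp
    then show "regular (0 $ i) (cone U) (\<lambda>x. constant_field A y x $ i)"
      by (simp add: cf)
  qed
  moreover have "arrangement_deriv A x (constant_field A y x) = 0" if x: "x \<in> cone U" for x
  proof -
    have euler: "(\<Sum>H\<in>A. form_at H x * (\<Prod>K\<in>A - {H}. form_at K x)) = of_nat (card A) * defining_poly A x"
    proof -
      have "(\<Sum>H\<in>A. form_at H x * (\<Prod>K\<in>A - {H}. form_at K x)) = (\<Sum>H\<in>A. \<Prod>K\<in>A. form_at K x)"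
        using prod.remove[OF fin, of _ "\<lambda>K. form_at K x"] by (intro sum.cong) auto
      then show ?thesis by (simp add: defining_poly_def)
    qed
    have "r x * defining_poly A x = (\<Sum>H\<in>B. form_at H y * (\<Prod>K\<in>A - {H}. form_at K x))"
      unfolding r_def defining_poly_def sum_distrib_right
    proof (intro sum.cong refl)
      fix H assume "H \<in> B"
      then show "form_at H y / form_at H x * (\<Prod>H\<in>A. form_at H x) = form_at H y * (\<Prod>K\<in>A - {H}. form_at K x)"
        using K[OF _ x] B(2) prod.remove[OF fin, of H "\<lambda>H. form_at H x"] by auto
    qed
    also have "\<dots> = (\<Sum>H\<in>A. form_at H y * (\<Prod>K\<in>A - {H}. form_at K x))"
      using fin by (intro sum.mono_neutral_left) (auto simp: B_def)
    finally have y: "(\<Sum>H\<in>A. form_at H y * (\<Prod>K\<in>A - {H}. form_at K x)) = r x * defining_poly A x" ..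
    have "arrangement_deriv A x (constant_field A y x) =
        (\<Sum>H\<in>A. form_at H y * (\<Prod>K\<in>A - {H}. form_at K x)) -
        r x / of_nat (card A) * (\<Sum>H\<in>A. form_at H x * (\<Prod>K\<in>A - {H}. form_at K x))"
      unfolding arrangement_deriv_def cf by (simp add: linear_form_simps algebra_simps sum_subtractf sum_distrib_left)
    also have "\<dots> = 0"
      unfolding y euler using A(2) fin by simp
    finally show ?thesis .
  qed
  ultimately have "restr U (constant_field A y) \<in> arrangement_bundle A U"
    unfolding arrangement_bundle_iff[OF A(1) U] by (auto simp: restr_def)
  with U coneU show thesis by (rule that)
qed

section \<open>Regular functions on a projective line\<close>

lemma isCont_regular_punctured:
  "regular k (- {0}) s \<Longrightarrow> v \<noteq> 0 \<Longrightarrow> isCont s v"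
  by (rule isCont_regular[where C = "- {0}"]) auto

lemma isCont_regular_on_line:
  assumes "regular k C s" "open C" "u + a *s w \<in> C"
  shows "isCont (\<lambda>t. s (u + t *s w)) (a :: complex)"
  by (rule isCont_o2[OF isCont_affine_line isCont_regular[OF assms]])

text \<open>In the affine parameter \<open>t\<close> of the line a global regular function of degree \<open>k\<close> is entire, and the
  chart at infinity bounds its growth by \<open>t ^ k\<close>; Liouville's theorem makes it a polynomial. Its
  value at infinity is the coefficient in degree \<open>k\<close>.\<close>

lemma regular_on_line_poly:
  assumes s: "regular k (- {0}) s" and indep: "\<And>x y. x *s u + y *s w = 0 \<Longrightarrow> x = 0 \<and> y = 0"
  obtains p where "\<And>t. s (u + t *s w) = poly p t" "p \<noteq> 0 \<Longrightarrow> int (degree p) \<le> k"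
    "s w = (if k \<ge> 0 then coeff p (nat k) else 0)"
    "p = 0 \<Longrightarrow> x *s u + y *s w \<noteq> 0 \<Longrightarrow> s (x *s u + y *s w) = 0"
proof -
  define F where "F t = s (u + t *s w)" for t
  define g where "g t = s (w + t *s u)" for t
  have nz: "u + t *s w \<noteq> 0" "w + t *s u \<noteq> 0" for t
    using indep[of 1 t] indep[of t 1] by (auto simp: add.commute)
  have hol: "F holomorphic_on UNIV"
  proof (unfold holomorphic_on_def, rule ballI)
    fix a :: complex
    have "u + a *s w \<in> - {0}" using nz by simp
    then obtain i P j Q where PQ: "hom_poly i P" "hom_poly j Q" and Qa: "Q (u + a *s w) \<noteq> 0"
      and eq: "\<forall>x\<in>- {0}. Q x \<noteq> 0 \<longrightarrow> s x = P x / Q x"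
      by (rule regularE[OF s]) (rule that)
    obtain p where p: "\<And>t. P (u + t *s w) = poly p t" using hom_poly_on_line[OF PQ(1)] by blast
    obtain q where q: "\<And>t. Q (u + t *s w) = poly q t" using hom_poly_on_line[OF PQ(2)] by blast
    have qa: "poly q a \<noteq> 0" using Qa q by simp
    have "((\<lambda>t. poly p t / poly q t) has_field_derivative
        ((poly (pderiv p) a * poly q a - poly p a * poly (pderiv q) a) / (poly q a * poly q a))) (at a)"
      by (intro DERIV_divide poly_DERIV qa)
    moreover have "open {t. poly q t \<noteq> 0}"
      by (intro open_Collect_neq continuous_intros)
    ultimately have "(F has_field_derivative
        ((poly (pderiv p) a * poly q a - poly p a * poly (pderiv q) a) / (poly q a * poly q a))) (at a)"
    proof (rule has_field_derivative_transform_within_open)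
      show "a \<in> {t. poly q t \<noteq> 0}" using qa by simp
      show "poly p t / poly q t = F t" if "t \<in> {t. poly q t \<noteq> 0}" for t
        using bspec[OF eq, of "u + t *s w"] nz that by (simp add: F_def flip: p q)
    qed
    then show "F field_differentiable at a within UNIV"
      unfolding field_differentiable_def by auto
  qed
  have contg: "isCont g 0"
    unfolding g_def by (rule isCont_regular_on_line[OF s]) (use nz(2)[of 0] in \<open>auto intro: open_Compl\<close>)
  then obtain r where r: "r > 0" and gr: "\<And>t. cmod t < r \<Longrightarrow> cmod (g t) < cmod (g 0) + 1"
  proof -
    obtain r where "r > 0" and r: "\<And>t. dist t 0 < r \<Longrightarrow> dist (g t) (g 0) < 1"
      using contg unfolding continuous_at_eps_delta by (metis zero_less_one)
    have "cmod (g t) < cmod (g 0) + 1" if "cmod t < r" for t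
      using r[of t] that norm_triangle_ineq2[of "g t" "g 0"] by (simp add: dist_norm)
    then show thesis using that[of r] \<open>r > 0\<close> by blast
  qed
  have Fg: "F t = t powi k * g (1 / t)" if "t \<noteq> 0" for t
  proof -
    have "u + t *s w = t *s (w + (1 / t) *s u)"
      using that by (simp add: vec.scale_right_distrib add.commute)
    then show ?thesis
      unfolding F_def g_def using regular_scale[OF s, of "w + (1 / t) *s u" t] nz that
      by (metis Compl_iff singletonD)
  qed
  have growth: "cmod (F t) \<le> (cmod (g 0) + 1) * cmod t ^ nat k" if t: "2 / r + 1 \<le> cmod t" for t
  proof -
    have t1: "cmod t \<ge> 1" "cmod t > 1 / r"
    proof -
      have "2 / r = 2 * (1 / r)" "1 / r > 0" using r by simp_all
      with t show "cmod t \<ge> 1" "cmod t > 1 / r" by linarith+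
    qed
    then have "t \<noteq> 0" by auto
    have "cmod (1 / t) < r"
    proof -
      have "cmod t > 0" using t1 by linarith
      then show ?thesis using t1(2) r by (simp add: norm_divide field_simps)
    qed
    from gr[OF this] have 1: "cmod (g (1 / t)) \<le> cmod (g 0) + 1" by simp
    have 2: "cmod t powi k \<le> cmod t ^ nat k"
    proof (cases "k \<ge> 0")
      case False
      then have "cmod t powi k \<le> cmod t powi 0"
        using t1 by (intro power_int_increasing) auto
      then show ?thesis using False by simp
    qed (simp add: power_int_def)
    have "cmod (F t) = cmod t powi k * cmod (g (1 / t))"
      unfolding Fg[OF \<open>t \<noteq> 0\<close>] by (simp add: norm_mult norm_power_int)
    also have "\<dots> \<le> cmod t ^ nat k * (cmod (g 0) + 1)"
      using 1 2 by (intro mult_mono) auto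
    finally show ?thesis by (simp add: mult.commute)
  qed
  define c where "c i = (deriv ^^ i) F 0 / fact i" for i
  have Fsum: "F t = (\<Sum>i\<le>nat k. c i * t ^ i)" for t
    unfolding c_def by (rule Liouville_polynomial[OF hol growth])
  define p where "p = (if k \<ge> 0 then (\<Sum>i\<le>nat k. monom (c i) i) else 0)"
  have coeffp: "coeff p i = (if k \<ge> 0 \<and> i \<le> nat k then c i else 0)" for i
    by (auto simp: p_def coeff_sum if_distrib cong: if_cong)
  have glim: "g 0 = (if k \<ge> 0 then c (nat k) else 0) \<and> (k < 0 \<longrightarrow> c 0 = 0)"
  proof (cases "k \<ge> 0")
    case True
    have "g t = (\<Sum>i\<le>nat k. c i * t ^ (nat k - i))" if "t \<noteq> 0" for t
    proof -
      have "g t = t ^ nat k * F (1 / t)"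
        using Fg[of "1 / t"] that True by (simp add: power_int_def power_divide)
      also have "\<dots> = (\<Sum>i\<le>nat k. c i * t ^ (nat k - i))"
        unfolding Fsum sum_distrib_left using that
        by (intro sum.cong) (auto simp: power_divide power_diff)
      finally show ?thesis .
    qed
    then have "\<forall>\<^sub>F t in at 0. g t = (\<Sum>i\<le>nat k. c i * t ^ (nat k - i))"
      by (simp add: eventually_at_filter)
    moreover have "isCont (\<lambda>t. \<Sum>i\<le>nat k. c i * t ^ (nat k - i)) 0"
      by (intro continuous_intros)
    ultimately have "g 0 = (\<Sum>i\<le>nat k. c i * 0 ^ (nat k - i))"
      using isCont_eq_limit[OF contg] by fast
    also have "\<dots> = (\<Sum>i\<le>nat k. if i = nat k then c i else 0)"
      by (intro sum.cong) auto
    finally show ?thesis using True by simp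
  next
    case False
    have F: "F t = c 0" for t using Fsum[of t] False by simp
    have gc: "c 0 = t ^ nat (- k) * g t" if "t \<noteq> 0" for t
      using Fg[of "1 / t"] that False by (simp add: F power_int_def power_divide)
    then have "\<forall>\<^sub>F t in at 0. c 0 = t ^ nat (- k) * g t"
      by (simp add: eventually_at_filter)
    moreover have "isCont (\<lambda>t. t ^ nat (- k) * g t) 0"
      by (intro continuous_intros contg)
    ultimately have c0: "c 0 = 0 ^ nat (- k) * g 0"
      using isCont_eq_limit[of 0 "\<lambda>_. c 0" "\<lambda>t. t ^ nat (- k) * g t"] by simp
    then have c0: "c 0 = 0" using False by simp
    have "\<forall>\<^sub>F t in at 0. g t = 0"
      using gc c0 by (simp add: eventually_at_filter)
    then have "g 0 = 0" using isCont_eq_limit[OF contg, of "\<lambda>_. 0"] by simp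
    then show ?thesis using c0 False by simp
  qed
  have Fp: "F t = poly p t" for t
  proof (cases "k \<ge> 0")
    case True
    then show ?thesis unfolding Fsum p_def by (simp add: poly_sum poly_monom)
  next
    case False
    then show ?thesis using Fsum[of t] glim by (simp add: p_def)
  qed
  show thesis
  proof (rule that[of p])
    show "s (u + t *s w) = poly p t" for t using Fp[of t] by (simp add: F_def)
    show "int (degree p) \<le> k" if "p \<noteq> 0"
    proof -
      have "coeff p (degree p) \<noteq> 0" using that by simp
      then have "k \<ge> 0 \<and> degree p \<le> nat k" unfolding coeffp by presburger
      then show ?thesis by linarith
    qed
    show sw: "s w = (if k \<ge> 0 then coeff p (nat k) else 0)"
      using glim by (simp add: coeffp g_def)
    show "s (x *s u + y *s w) = 0" if "p = 0" and xy: "x *s u + y *s w \<noteq> 0" for x y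
    proof (cases "x = 0")
      case True
      then have y: "y \<noteq> 0" "y *s w \<noteq> 0" using xy by auto
      then have "s (y *s w) = y powi k * s w"
        using regular_scale[OF s, of w y] by fastforce
      then show ?thesis using sw that True by (simp split: if_splits)
    next
      case False
      have e: "x *s u + y *s w = x *s (u + (y / x) *s w)"
        using False by (simp add: vec.scale_right_distrib)
      have "x *s (u + (y / x) *s w) \<in> - {0}" "u + (y / x) *s w \<in> - {0}"
        using xy nz(1) unfolding e by (metis ComplI singletonD)+
      then have "s (x *s (u + (y / x) *s w)) = x powi k * s (u + (y / x) *s w)"
        using regular_scale[OF s] False by blast
      moreover have "s (u + (y / x) *s w) = 0"
        using Fp[of "y / x"] that unfolding F_def by simp
      ultimately show ?thesis unfolding e by simp
    qed
  qed
qed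

section \<open>Polynomials in one variable\<close>

lemma prod_linear_factors_dvd:
  assumes "finite T" "\<And>t. t \<in> T \<Longrightarrow> poly p t = (0 :: complex)"
  shows "(\<Prod>t\<in>T. [:- t, 1:]) dvd p"
  using assms
proof (induction T rule: finite_induct)
  case (insert a T)
  then obtain q where q: "p = (\<Prod>t\<in>T. [:- t, 1:]) * q" by (auto elim: dvdE)
  have "poly (\<Prod>t\<in>T. [:- t, 1:]) a \<noteq> 0"
    using insert.hyps by (auto simp: poly_prod)
  moreover have "poly p a = 0" using insert.prems by simp
  ultimately have "[:- a, 1:] dvd q"
    unfolding q poly_mult by (simp add: poly_eq_0_iff_dvd)
  then have "[:- a, 1:] * (\<Prod>t\<in>T. [:- t, 1:]) dvd q * (\<Prod>t\<in>T. [:- t, 1:])"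
    by (rule mult_dvd_mono) simp
  then show ?case unfolding q prod.insert[OF insert.hyps] by (simp only: mult.commute)
qed simp

lemma dvd_mult_no_common_root:
  fixes p q r :: "complex poly"
  assumes "p \<noteq> 0" "p dvd q * r" "\<And>z. poly p z = 0 \<Longrightarrow> poly r z \<noteq> 0"
  shows "p dvd q"
  using assms
proof (induction "degree p" arbitrary: p q)
  case 0
  then obtain c where "p = [:c:]" by (metis degree_eq_zeroE)
  then show ?case using 0 by (simp add: const_poly_dvd_iff dvd_field_iff)
next
  case (Suc n)
  have "degree p > 0" using Suc.hyps(2) by simp
  then obtain z where z: "poly p z = 0"
    using alg_closed_imp_poly_has_root by blast
  then obtain p' where p': "p = [:- z, 1:] * p'"
    by (metis poly_eq_0_iff_dvd dvdE)
  have "p' \<noteq> 0" using Suc.prems(1) p' by auto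
  obtain k where "q * r = p * k" using Suc.prems(2) by (rule dvdE)
  then have "poly (q * r) z = 0" using z by (metis poly_mult mult_zero_left)
  then have "poly q z = 0" using Suc.prems(3)[OF z] by simp
  then obtain q' where q': "q = [:- z, 1:] * q'"
    by (metis poly_eq_0_iff_dvd dvdE)
  have "[:- z, 1:] * p' dvd [:- z, 1:] * (q' * r)"
    using Suc.prems(2) unfolding p' q' by (simp only: mult.assoc)
  then have "p' dvd q' * r"
    by (subst (asm) dvd_mult_cancel_left) simp
  moreover have "n = degree p'"
    using Suc.hyps(2) \<open>p' \<noteq> 0\<close> unfolding p' by (simp add: degree_mult_eq del: mult_pCons_left)
  moreover have "poly r z' \<noteq> 0" if "poly p' z' = 0" for z'
    using Suc.prems(3)[of z'] that unfolding p' by simp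
  ultimately have "p' dvd q'"
    using Suc.hyps(1) \<open>p' \<noteq> 0\<close> by blast
  then show ?case unfolding p' q' by (rule mult_dvd_mono[OF dvd_refl])
qed

section \<open>The resolution of the bundle\<close>

text \<open>A resolution of the bundle of an arrangement in terms of functions: vector fields \<open>\<Theta> i\<close> of degree
  \<open>D $ i\<close> that generate the bundle, and a single generating relation \<open>L\<close> among them, the image of
  \<open>\<O>(e)\<close>.\<close>

locale plus_one_resolution =
  fixes A :: "point set set" and D :: "int ^ 3" and e :: int
    and L :: "complex ^ 3 \<Rightarrow> complex ^ 3" and \<Theta> :: "3 \<Rightarrow> complex ^ 3 \<Rightarrow> complex ^ 3"
  assumes arrangement: "arrangement A"
    and L_regular: "regular (- (D $ i) - e) (- {0}) (\<lambda>v. L v $ i)"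
    and \<Theta>_regular: "regular (D $ i) (- {0}) (\<lambda>v. \<Theta> i v $ j)"
    and L_nonzero: "\<exists>v. v \<noteq> 0 \<and> L v \<noteq> 0"
    and relation: "v \<noteq> 0 \<Longrightarrow> (\<Sum>i\<in>UNIV. L v $ i *s \<Theta> i v) = 0"
    and \<Theta>_annihilates: "v \<noteq> 0 \<Longrightarrow> arrangement_deriv A v (\<Theta> i v) = 0"
    and syzygy: "\<lbrakk>zariski_open U; \<And>i. regular (- (D $ i)) (cone U) (\<lambda>x. s x $ i);
      \<And>x. x \<in> cone U \<Longrightarrow> (\<Sum>i\<in>UNIV. s x $ i *s \<Theta> i x) = 0; v \<in> cone U\<rbrakk> \<Longrightarrow>
      \<exists>V g. zariski_open V \<and> v \<in> cone V \<and> cone V \<subseteq> cone U \<and> regular e (cone V) g \<and>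
        (\<forall>x\<in>cone V. s x = g x *s L x)"
    and generates: "\<lbrakk>zariski_open U; t \<in> arrangement_bundle A U; v \<in> cone U\<rbrakk> \<Longrightarrow>
      \<exists>V s. zariski_open V \<and> v \<in> cone V \<and> cone V \<subseteq> cone U \<and>
        (\<forall>i. regular (- (D $ i)) (cone V) (\<lambda>x. s x $ i)) \<and> (\<forall>x\<in>cone V. t x = (\<Sum>i\<in>UNIV. s x $ i *s \<Theta> i x))"

lemma plus_one_generated_resolution:
  assumes A: "arrangement A" and gen: "plus_one_generated A a b d"
  obtains L \<Theta> where "plus_one_resolution A (vector [d, b, a]) (- 1 - d) L \<Theta>"
proof -
  let ?k = "vector [- d, - b, - a] :: int ^ 3"
  obtain \<phi> \<psi> where exact: "short_exact (twist_sum (vector [- 1 - d] :: int ^ 1)) \<phi> (twist_sum ?k) \<psi> (arrangement_bundle A)"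
    using gen unfolding plus_one_generated_def by blast
  have sub: "arrangement_bundle A U \<subseteq> twist_sum 0 U" if "zariski_open U" for U
    using arrangement_bundle_iff[OF A that] by blast
  have k: "?k $ i = - (vector [d, b, a] :: int ^ 3) $ i" for i
    using exhaust_3[of i] by auto
  show thesis
  proof (rule short_exact_matrices[OF exact])
    show "arrangement_bundle A U \<subseteq> twist_sum 0 U" if "zariski_open U" for U
      by (rule sub[OF that])
  next
    fix L :: "complex ^ 3 \<Rightarrow> complex ^ 3" and \<Theta> :: "3 \<Rightarrow> complex ^ 3 \<Rightarrow> complex ^ 3"
    assume
    1: "\<And>i. regular (?k $ i - (- 1 - d)) (- {0}) (\<lambda>v. L v $ i)" and
    2: "\<And>i j. regular ((0 :: int ^ 3) $ j - ?k $ i) (- {0}) (\<lambda>v. \<Theta> i v $ j)" and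
    3: "\<exists>v. v \<noteq> 0 \<and> L v \<noteq> 0" and
    4: "\<And>v. v \<noteq> 0 \<Longrightarrow> (\<Sum>i\<in>UNIV. L v $ i *s \<Theta> i v) = 0" and
    5: "\<And>U s. zariski_open U \<Longrightarrow> (\<And>i. regular (?k $ i) (cone U) (\<lambda>x. s x $ i)) \<Longrightarrow>
      restr U (\<lambda>x. \<Sum>i\<in>UNIV. s x $ i *s \<Theta> i x) \<in> arrangement_bundle A U" and
    6: "\<And>U s v. zariski_open U \<Longrightarrow> (\<And>i. regular (?k $ i) (cone U) (\<lambda>x. s x $ i)) \<Longrightarrow>
      (\<And>x. x \<in> cone U \<Longrightarrow> (\<Sum>i\<in>UNIV. s x $ i *s \<Theta> i x) = 0) \<Longrightarrow> v \<in> cone U \<Longrightarrow>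
      \<exists>V g. zariski_open V \<and> v \<in> cone V \<and> cone V \<subseteq> cone U \<and> regular (- 1 - d) (cone V) g \<and>
        (\<forall>x\<in>cone V. s x = g x *s L x)" and
    7: "\<And>U t v. zariski_open U \<Longrightarrow> t \<in> arrangement_bundle A U \<Longrightarrow> v \<in> cone U \<Longrightarrow>
      \<exists>V s. zariski_open V \<and> v \<in> cone V \<and> cone V \<subseteq> cone U \<and>
        (\<forall>i. regular (?k $ i) (cone V) (\<lambda>x. s x $ i)) \<and> (\<forall>x\<in>cone V. t x = (\<Sum>i\<in>UNIV. s x $ i *s \<Theta> i x))"
  have "plus_one_resolution A (vector [d, b, a]) (- 1 - d) L \<Theta>"
  proof
    show "regular (- ((vector [d, b, a] :: int ^ 3) $ i) - (- 1 - d)) (- {0}) (\<lambda>v. L v $ i)" for i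
      using 1[of i] unfolding k by simp
    show "regular ((vector [d, b, a] :: int ^ 3) $ i) (- {0}) (\<lambda>v. \<Theta> i v $ j)" for i j
      using 2[of j i] unfolding k by simp
    show "arrangement_deriv A v (\<Theta> i v) = 0" if "v \<noteq> 0" for v i
    proof -
      obtain q where q: "v $ q \<noteq> 0" using exists_coord_nonzero[OF \<open>v \<noteq> 0\<close>] by blast
      let ?U = "nonvanishing (\<lambda>v. v $ q)"
      have U: "zariski_open ?U" by (rule zariski_open_nonvanishing[OF hom_poly_coord])
      have coneU: "cone ?U = {v. v $ q \<noteq> 0}"
        unfolding cone_nonvanishing[OF hom_poly_coord] by auto
      define s :: "complex ^ 3 \<Rightarrow> complex ^ 3" where "s x = (x $ q) powi (?k $ i) *s axis i 1" for x
      have s: "regular (?k $ j) (cone ?U) (\<lambda>x. s x $ j)" for j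
        using regular_power_int[OF hom_poly_coord[of q], of "cone ?U" "?k $ i"]
          regular_zero[OF zero_notin_cone[of ?U], of "?k $ j"]
        by (cases "i = j") (auto simp: s_def axis_def coneU)
      have "(\<Sum>j\<in>UNIV. s v $ j *s \<Theta> j v) = (\<Sum>j\<in>UNIV. if j = i then (v $ q) powi (?k $ i) *s \<Theta> i v else 0)"
        by (intro sum.cong) (auto simp: s_def axis_def)
      then have "restr ?U (\<lambda>x. \<Sum>i\<in>UNIV. s x $ i *s \<Theta> i x) v = (v $ q) powi (?k $ i) *s \<Theta> i v"
        using q by (simp add: restr_def coneU)
      then have "arrangement_deriv A v ((v $ q) powi (?k $ i) *s \<Theta> i v) = 0"
        using 5[of ?U s, OF U s] q unfolding arrangement_bundle_iff[OF A U] by (auto simp: coneU)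
      then show ?thesis using q by (simp add: arrangement_deriv_scale)
    qed
  qed (use A 3 4 6 7 k in simp_all)
  then show thesis by (rule that)
  qed
qed

text \<open>The complement of a line is dense, so identities obtained by cancelling the form of the line
  extend across it.\<close>

lemma zero_off_line_imp_zero:
  assumes "c \<noteq> 0" and f: "isCont f v" and N: "open N" "v \<in> N"
    and zero: "\<And>x. x \<in> N \<Longrightarrow> linear_form c x \<noteq> 0 \<Longrightarrow> f x = (0 :: complex)"
  shows "f v = 0"
proof (cases "linear_form c v = 0")
  case True
  obtain z where z: "linear_form c z = 1"
    using exists_linear_form_eq_1[OF \<open>c \<noteq> 0\<close>] .
  have "open ((\<lambda>t. v + t *s z) -` N)"
    by (intro continuous_open_vimage N isCont_affine_line)
  moreover have "0 \<in> (\<lambda>t. v + t *s z) -` N" using N by simp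
  ultimately have "\<forall>\<^sub>F t in at 0. t \<in> (\<lambda>t. v + t *s z) -` N"
    by (rule eventually_at_in_open')
  moreover have "\<forall>\<^sub>F t in at 0. t \<noteq> (0 :: complex)"
    by (simp add: eventually_at_filter)
  ultimately have "\<forall>\<^sub>F t in at 0. f (v + t *s z) = 0"
    by eventually_elim (auto intro!: zero simp: linear_form_simps True z)
  moreover have "isCont (\<lambda>t. f (v + t *s z)) 0"
    by (rule isCont_o2[OF isCont_affine_line]) (simp add: f)
  ultimately have "f (v + 0 *s z) = 0"
    using isCont_eq_limit[of 0 "\<lambda>t. f (v + t *s z)" "\<lambda>_. 0"] by simp
  then show ?thesis by simp
qed (use zero N in auto)

text \<open>On the resulting neighbourhood a coordinate is invertible, so its powers can correct degrees.\<close>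

lemma divide_by_line:
  assumes c: "c \<noteq> 0" and F: "\<And>i. regular (k $ i) (- {0}) (\<lambda>v. F v $ i)"
    and zero: "\<And>x. x \<noteq> 0 \<Longrightarrow> linear_form c x = 0 \<Longrightarrow> F x = 0"
    and v: "v \<noteq> 0" "linear_form c v = 0"
  obtains V q F' where "zariski_open V" "v \<in> cone V" "\<And>x. x \<in> cone V \<Longrightarrow> x $ q \<noteq> 0"
    "\<And>i. regular (k $ i - 1) (cone V) (\<lambda>x. F' x $ i)"
    "\<And>x. x \<in> cone V \<Longrightarrow> F x = linear_form c x *s (F' x :: complex ^ 3)"
proof -
  obtain q where q: "v $ q \<noteq> 0" using exists_coord_nonzero[OF v(1)] by blast
  have "\<exists>V s. zariski_open V \<and> v \<in> cone V \<and> regular (k $ i - 1) (cone V) s \<and>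
      (\<forall>x\<in>cone V. F x $ i = linear_form c x * s x)" for i
  proof -
    obtain m g s where g: "hom_poly m g" "g v \<noteq> 0" "regular (k $ i - 1) {x \<in> - {0}. g x \<noteq> 0} s"
      "\<And>x. x \<in> - {0} \<Longrightarrow> g x \<noteq> 0 \<Longrightarrow> F x $ i = linear_form c x * s x"
      using regular_divide_linear_form[OF F[of i], of v c] c v zero by (auto simp: open_Compl)
    have "cone (nonvanishing g) = {x \<in> - {0}. g x \<noteq> 0}"
      unfolding cone_nonvanishing[OF g(1)] by auto
    then show ?thesis
      using g v zariski_open_nonvanishing[OF g(1)]
      by (intro exI[of _ "nonvanishing g"] exI[of _ s]) auto
  qed
  then obtain W s where W: "\<And>i. zariski_open (W i)" "\<And>i. v \<in> cone (W i)"
    and s: "\<And>i. regular (k $ i - 1) (cone (W i)) (s i)"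
    and eq: "\<And>i x. x \<in> cone (W i) \<Longrightarrow> F x $ i = linear_form c x * s i x"
    by metis
  define V where "V = W 1 \<inter> W 2 \<inter> W 3 \<inter> nonvanishing (\<lambda>x. x $ q)"
  have V: "zariski_open V"
    unfolding V_def by (intro zariski_open_Int W zariski_open_nonvanishing[OF hom_poly_coord])
  have coneV: "cone V = cone (W 1) \<inter> cone (W 2) \<inter> cone (W 3) \<inter> {x. x \<noteq> 0 \<and> x $ q \<noteq> 0}"
    unfolding V_def cone_Int cone_nonvanishing[OF hom_poly_coord] ..
  have sub: "cone V \<subseteq> cone (W i)" for i
    using exhaust_3[of i] coneV by auto
  show thesis
  proof (rule that[OF V])
    show "v \<in> cone V" using coneV W(2) v q by simp
    show "x $ q \<noteq> 0" if "x \<in> cone V" for x using that coneV by simp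
    show "regular (k $ i - 1) (cone V) (\<lambda>x. (\<chi> i. s i x) $ i)" for i
      using regular_subset[OF s sub] by simp
    show "F x = linear_form c x *s (\<chi> i. s i x)" if "x \<in> cone V" for x
      using eq subsetD[OF sub that] by (simp add: vec_eq_iff)
  qed
qed

locale resolution_on_line = plus_one_resolution A D e L \<Theta> + line_basis "form_of l" u w lu lw
  for A D e L \<Theta> l u w lu lw +
  assumes l: "l \<in> A" and general: "H \<in> A - {l} \<Longrightarrow> form_at H w \<noteq> 0"
begin

lemma form_l: "form_of l \<noteq> 0"
  by (rule form_of(1)[OF arrangement l])

lemma coordinates_independent: "x *s u + y *s w = 0 \<Longrightarrow> x = 0 \<and> y = 0"
proof -
  assume *: "x *s u + y *s w = 0"
  have "linear_form lu (x *s u + y *s w) = 0" "linear_form lw (x *s u + y *s w) = 0"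
    unfolding * by (simp_all add: linear_form_zero)
  then show "x = 0 \<and> y = 0" by (simp add: linear_form_simps lu lw)
qed

lemma zero_on_line:
  assumes "regular k (- {0}) s" "\<And>t. s (u + t *s w) = 0" "v \<noteq> 0" "form_at l v = 0"
  shows "s v = 0"
proof -
  obtain p where p: "\<And>t. s (u + t *s w) = poly p t"
    and z: "\<And>x y. p = 0 \<Longrightarrow> x *s u + y *s w \<noteq> 0 \<Longrightarrow> s (x *s u + y *s w) = 0"
    using regular_on_line_poly[OF assms(1) coordinates_independent] by metis
  have "p = 0" using p assms(2) by (simp flip: poly_all_0_iff_0)
  then show ?thesis using z expand[OF assms(4)] assms(3) by metis
qed

text \<open>If \<open>L\<close> vanished on the line, then \<open>L\<close> divided by the form of the line would again be a relation,
  as the bundle has no torsion, so locally \<open>L / form_at l = g L\<close>. Then \<open>(1 - form_at l * g) L = 0\<close>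
  near a point of the line, where the first factor is invertible. Thus \<open>L\<close> vanishes near that point,
  hence along every line through it, hence everywhere.\<close>

lemma L_not_zero_on_line: "\<exists>v. v \<noteq> 0 \<and> form_at l v = 0 \<and> L v \<noteq> 0"
proof (rule ccontr)
  assume "\<not> ?thesis"
  then have zero: "L v = 0" if "v \<noteq> 0" "form_at l v = 0" for v using that by blast
  let ?k = "(\<chi> i. - (D $ i) - e) :: int ^ 3"
  have reg: "regular (?k $ i) (- {0}) (\<lambda>v. L v $ i)" for i
    using L_regular[of i] by simp
  obtain V q L' where V: "zariski_open V" "w \<in> cone V" and q: "\<And>x. x \<in> cone V \<Longrightarrow> x $ q \<noteq> 0"
    and L': "\<And>i. regular (?k $ i - 1) (cone V) (\<lambda>x. L' x $ i)"
    and LL': "\<And>x. x \<in> cone V \<Longrightarrow> L x = form_at l x *s L' x"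
    using divide_by_line[OF form_l reg zero w_nonzero form_w] by metis
  define \<kappa> where "\<kappa> x = (x $ q) powi (e + 1) *s L' x" for x
  have \<kappa>: "regular (- (D $ i)) (cone V) (\<lambda>x. \<kappa> x $ i)" for i
    using regular_mult[OF regular_power_int[OF hom_poly_coord[of q], of "cone V" "e + 1"] L'[of i]] q
    by (simp add: \<kappa>_def)
  have "(\<Sum>i\<in>UNIV. \<kappa> x $ i *s \<Theta> i x) $ j = 0" if x: "x \<in> cone V" for x j
  proof (rule zero_off_line_imp_zero[OF form_l _ open_cone[OF V(1)] x])
    have "isCont (\<lambda>x. \<Theta> i x $ j) x" for i
      using isCont_regular_punctured[OF \<Theta>_regular] x zero_notin_cone[of V] by metis
    then show "isCont (\<lambda>x. (\<Sum>i\<in>UNIV. \<kappa> x $ i *s \<Theta> i x) $ j) x"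
      unfolding sum_component vector_smult_component
      by (intro continuous_sum continuous_mult isCont_regular[OF \<kappa> open_cone[OF V(1)] x])
  next
    fix y assume y: "y \<in> cone V" "form_at l y \<noteq> 0"
    have "form_at l y *s (\<Sum>i\<in>UNIV. \<kappa> y $ i *s \<Theta> i y) = (y $ q) powi (e + 1) *s (\<Sum>i\<in>UNIV. L y $ i *s \<Theta> i y)"
      unfolding vec.scale_sum_right by (intro sum.cong) (simp_all add: \<kappa>_def LL'[OF y(1)] mult_ac)
    also have "\<dots> = 0"
      using relation[of y] y(1) zero_notin_cone by (metis vec.scale_zero_right)
    finally show "(\<Sum>i\<in>UNIV. \<kappa> y $ i *s \<Theta> i y) $ j = 0" using y(2) by simp
  qed
  then have "(\<Sum>i\<in>UNIV. \<kappa> x $ i *s \<Theta> i x) = 0" if "x \<in> cone V" for x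
    using that by (simp add: vec_eq_iff)
  from syzygy[OF V(1) \<kappa> this V(2)]
  obtain W g where W: "zariski_open W" "w \<in> cone W" "cone W \<subseteq> cone V"
    and g: "regular e (cone W) g" and \<kappa>g: "\<And>x. x \<in> cone W \<Longrightarrow> \<kappa> x = g x *s L x"
    by metis
  define h where "h x = (x $ q) powi (e + 1) - form_at l x * g x" for x
  have hL: "h x *s L x = 0" if "x \<in> cone W" for x
  proof -
    have "form_at l x *s (g x *s L x) = form_at l x *s \<kappa> x"
      by (simp only: \<kappa>g[OF that])
    also have "\<dots> = (x $ q) powi (e + 1) *s (form_at l x *s L' x)"
      by (simp add: \<kappa>_def mult.commute)
    also have "\<dots> = (x $ q) powi (e + 1) *s L x"
      using LL'[of x] that W(3) by (simp add: subset_iff)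
    finally show ?thesis by (auto simp: h_def vec.scale_left_diff_distrib)
  qed
  have "regular (e + 1) (cone W) h"
    unfolding h_def
  proof (intro regular_diff)
    show "regular (e + 1) (cone W) (\<lambda>x. (x $ q) powi (e + 1))"
      using q W(3) by (intro regular_power_int[OF hom_poly_coord]) auto
    show "regular (e + 1) (cone W) (\<lambda>x. form_at l x * g x)"
      using regular_mult[OF regular_hom_poly[OF hom_poly_linear_form] g] by (simp add: add.commute)
  qed
  then have "isCont h w" by (rule isCont_regular[OF _ open_cone[OF W(1)] W(2)])
  moreover have "h w \<noteq> 0" using q[of w] W by (auto simp: h_def form_w)
  ultimately have "\<forall>\<^sub>F x in nhds w. h x \<noteq> 0"
    unfolding isCont_def tendsto_at_iff_tendsto_nhds by (rule tendsto_imp_eventually_ne)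
  moreover have "\<forall>\<^sub>F x in nhds w. x \<in> cone W"
    by (intro eventually_nhds_in_open open_cone W)
  ultimately have "\<forall>\<^sub>F x in nhds w. L x = 0"
  proof eventually_elim
    case (elim x)
    then show ?case using hL[of x] by simp
  qed
  then obtain N where N: "open N" "w \<in> N" and LN: "\<And>x. x \<in> N \<Longrightarrow> L x = 0"
    unfolding eventually_nhds by blast
  have "L v $ i = 0" if v: "v \<noteq> 0" for v i
  proof (cases "\<exists>r. v = r *s w")
    case True
    then show ?thesis using zero[OF v] form_w by (auto simp: linear_form_simps)
  next
    case False
    have indep: "x = 0 \<and> y = 0" if "x *s w + y *s v = 0" for x y
    proof -
      have "y = 0"
      proof (rule ccontr)
        assume "y \<noteq> 0"
        have "v = (- x / y) *s w"
        proof -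
          have "y *s v = (- x) *s w" using that by (simp add: eq_neg_iff_add_eq_0 add.commute)
          then have "(1 / y) *s (y *s v) = (1 / y) *s ((- x) *s w)" by simp
          then show ?thesis using \<open>y \<noteq> 0\<close> by simp
        qed
        with False show False by blast
      qed
      then show ?thesis using that w_nonzero by simp
    qed
    obtain p where p: "\<And>t. L (w + t *s v) $ i = poly p t"
      and z: "\<And>x y. p = 0 \<Longrightarrow> x *s w + y *s v \<noteq> 0 \<Longrightarrow> L (x *s w + y *s v) $ i = 0"
      using regular_on_line_poly[OF L_regular[of i] indep] by metis
    have "open ((\<lambda>t. w + t *s v) -` N)"
      by (intro continuous_open_vimage N isCont_affine_line)
    moreover have "0 \<in> (\<lambda>t. w + t *s v) -` N" using N by simp
    ultimately have "infinite ((\<lambda>t. w + t *s v) -` N)"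
      using finite_imp_not_open by blast
    moreover have "(\<lambda>t. w + t *s v) -` N \<subseteq> {t. poly p t = 0}"
      using LN by (auto simp flip: p)
    ultimately have "p = 0"
      using poly_roots_finite[of p] finite_subset by blast
    then show ?thesis using z[of 0 1] v by simp
  qed
  then show False using L_nonzero by (auto simp: vec_eq_iff)
qed


text \<open>If all entries of the relation but one vanish on the line, the remaining generator vanishes there,
  hence is the linear form times a field \<open>\<rho>\<close> of the bundle. Writing \<open>\<rho>\<close> in the generators yields a
  relation with a unit in position \<open>j\<close>; it is a multiple of \<open>L\<close>, so \<open>L $ j\<close> has no zero on the line,
  contradicting its positive degree.\<close>

lemma relation_not_concentrated_on_line:
  assumes pos: "- (D $ j) - e > 0"
    and others: "\<And>i v. i \<noteq> j \<Longrightarrow> v \<noteq> 0 \<Longrightarrow> form_at l v = 0 \<Longrightarrow> L v $ i = 0"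
  shows False
proof -
  obtain p where p: "\<And>t. L (u + t *s w) $ j = poly p t" and Lw: "L w $ j = coeff p (nat (- (D $ j) - e))"
    and p0: "\<And>x y. p = 0 \<Longrightarrow> x *s u + y *s w \<noteq> 0 \<Longrightarrow> L (x *s u + y *s w) $ j = 0"
    using regular_on_line_poly[OF L_regular[of j] coordinates_independent] pos by (metis less_imp_le)
  have "p \<noteq> 0"
  proof
    assume "p = 0"
    obtain v where v: "v \<noteq> 0" "form_at l v = 0" "L v \<noteq> 0" using L_not_zero_on_line by blast
    have "L v $ j = 0" using p0[OF \<open>p = 0\<close>] expand[OF v(2)] v(1) by metis
    then have "L v $ i = 0" for i using others[OF _ v(1,2)] by (cases "i = j") auto
    then have "L v = 0" by (simp add: vec_eq_iff)
    with v(3) show False by contradiction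
  qed
  have \<Theta>j: "\<Theta> j v = 0" if v: "v \<noteq> 0" "form_at l v = 0" for v
  proof -
    have "\<Theta> j v $ i = 0" for i
    proof (rule zero_on_line[OF \<Theta>_regular _ v])
      fix t
      obtain r where r: "\<And>t. \<Theta> j (u + t *s w) $ i = poly r t"
        using regular_on_line_poly[OF \<Theta>_regular[of j i] coordinates_independent] by metis
      have "poly (p * r) t = 0" for t
      proof -
        let ?x = "u + t *s w"
        have "(\<Sum>i\<in>UNIV. L ?x $ i *s \<Theta> i ?x) = (\<Sum>i\<in>UNIV. if i = j then L ?x $ j *s \<Theta> j ?x else 0)"
          using others[OF _ line_point_nonzero form_line_point] by (intro sum.cong) auto
        then have "L ?x $ j *s \<Theta> j ?x = 0"
          using relation[OF line_point_nonzero] by simp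
        then have "(L ?x $ j *s \<Theta> j ?x) $ i = 0" by (simp only: zero_index)
        then show ?thesis by (simp add: p r)
      qed
      then have "p * r = 0" using poly_all_0_iff_0[of "p * r"] by blast
      then show "\<Theta> j (u + t *s w) $ i = 0" using \<open>p \<noteq> 0\<close> r by simp
    qed
    then show ?thesis by (simp add: vec_eq_iff)
  qed
  obtain v0 where v0: "v0 \<noteq> 0" "form_at l v0 = 0" "L v0 $ j = 0"
  proof (cases "degree p = 0")
    case True
    then have "coeff p (nat (- (D $ j) - e)) = 0" using pos by (intro coeff_eq_0) simp
    then show thesis using that[of w] w_nonzero form_w Lw by simp
  next
    case False
    then obtain t where "poly p t = 0" using alg_closed_imp_poly_has_root[of p] by auto
    then show thesis using that[of "u + t *s w"] line_point_nonzero form_line_point p by simp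
  qed
  have reg: "regular (vec (D $ j) $ i) (- {0}) (\<lambda>v. \<Theta> j v $ i)" for i
    using \<Theta>_regular[of j i] by simp
  obtain V q \<rho>' where V: "zariski_open V" "v0 \<in> cone V" and q: "\<And>x. x \<in> cone V \<Longrightarrow> x $ q \<noteq> 0"
    and \<rho>': "\<And>i. regular (vec (D $ j) $ i - 1) (cone V) (\<lambda>x. \<rho>' x $ i)"
    and \<Theta>\<rho>': "\<And>x. x \<in> cone V \<Longrightarrow> \<Theta> j x = form_at l x *s \<rho>' x"
    using divide_by_line[OF form_l reg \<Theta>j v0(1,2)] by metis
  define \<rho> where "\<rho> x = (x $ q) powi (1 - D $ j) *s \<rho>' x" for x
  have \<rho>: "regular 0 (cone V) (\<lambda>x. \<rho> x $ i)" for i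
    using regular_mult[OF regular_power_int[OF hom_poly_coord[of q], of "cone V" "1 - D $ j"] \<rho>'[of i]] q
    by (simp add: \<rho>_def)
  have "arrangement_deriv A x (\<rho> x) = 0" if x: "x \<in> cone V" for x
  proof (rule zero_off_line_imp_zero[OF form_l _ open_cone[OF V(1)] x])
    have "isCont (\<lambda>x. \<rho> x $ i) x" for i
      by (rule isCont_regular[OF \<rho> open_cone[OF V(1)] x])
    then have "isCont (\<lambda>x. form_at H (\<rho> x)) x" for H
      unfolding linear_form_def by (intro continuous_sum continuous_mult continuous_const)
    then show "isCont (\<lambda>x. arrangement_deriv A x (\<rho> x)) x"
      unfolding arrangement_deriv_def
      by (intro continuous_sum continuous_mult continuous_prod isCont_linear_form)
  next
    fix y assume y: "y \<in> cone V" "form_at l y \<noteq> 0"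
    have "form_at l y *s \<rho> y = (y $ q) powi (1 - D $ j) *s \<Theta> j y"
      by (simp add: \<rho>_def \<Theta>\<rho>'[OF y(1)] mult.commute)
    then have "form_at l y * arrangement_deriv A y (\<rho> y) = (y $ q) powi (1 - D $ j) * arrangement_deriv A y (\<Theta> j y)"
      by (simp flip: arrangement_deriv_scale)
    also have "\<dots> = 0" using \<Theta>_annihilates[of y j] y(1) zero_notin_cone[of V] by auto
    finally show "arrangement_deriv A y (\<rho> y) = 0" using y(2) by simp
  qed
  moreover have "restr V \<rho> \<in> twist_sum 0 V"
    by (rule restr_in_twist_sum[OF V(1)]) (simp add: \<rho>)
  ultimately have "restr V \<rho> \<in> arrangement_bundle A V"
    unfolding arrangement_bundle_iff[OF arrangement V(1)] by (auto simp: restr_def)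
  from generates[OF V(1) this V(2)]
  obtain W s where W: "zariski_open W" "v0 \<in> cone W" "cone W \<subseteq> cone V"
    and s: "\<And>i. regular (- (D $ i)) (cone W) (\<lambda>x. s x $ i)"
    and eq: "\<And>x. x \<in> cone W \<Longrightarrow> restr V \<rho> x = (\<Sum>i\<in>UNIV. s x $ i *s \<Theta> i x)"
    by (elim exE conjE) (rule that; blast)
  have \<rho>s: "\<rho> x = (\<Sum>i\<in>UNIV. s x $ i *s \<Theta> i x)" and xq: "x $ q \<noteq> 0" if "x \<in> cone W" for x
    using eq[OF that] W(3) q that by (auto simp: restr_def)
  \<comment> \<open>\<open>\<Theta> j\<close> equals \<open>form_at l\<close> times \<open>\<rho>\<close> and also itself; the difference of the two expressions in the
    generators is a relation, brought to the right degree by powers of the coordinate \<open>q\<close>.\<close>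
  define \<kappa> where "\<kappa> x = (form_at l x * (x $ q) powi (- 1)) *s s x - (x $ q) powi (- (D $ j)) *s axis j 1" for x
  have \<kappa>: "regular (- (D $ i)) (cone W) (\<lambda>x. \<kappa> x $ i)" for i
  proof -
    have "regular 1 (cone W) (linear_form (form_of l))"
      using regular_hom_poly[OF hom_poly_linear_form, of "cone W" "form_of l"] by simp
    moreover have "regular (- 1) (cone W) (\<lambda>x. (x $ q) powi (- 1))"
      using xq by (intro regular_power_int[OF hom_poly_coord])
    ultimately have "regular (1 + - 1 + - (D $ i)) (cone W) (\<lambda>x. form_at l x * (x $ q) powi (- 1) * s x $ i)"
      by (intro regular_mult s)
    then have 1: "regular (- (D $ i)) (cone W) (\<lambda>x. form_at l x * (x $ q) powi (- 1) * s x $ i)"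
      by simp
    have 2: "regular (- (D $ i)) (cone W) (\<lambda>x. (x $ q) powi (- (D $ j)) * axis j 1 $ i)"
      using regular_zero[OF zero_notin_cone[of W]] regular_power_int[OF hom_poly_coord[of q]] xq
      by (cases "i = j") (auto simp: axis_def)
    show ?thesis
      using regular_diff[OF 1 2] by (simp add: \<kappa>_def)
  qed
  have "(\<Sum>i\<in>UNIV. \<kappa> x $ i *s \<Theta> i x) = 0" if x: "x \<in> cone W" for x
  proof -
    have "(\<Sum>i\<in>UNIV. \<kappa> x $ i *s \<Theta> i x) =
        (\<Sum>i\<in>UNIV. (form_at l x * (x $ q) powi (- 1)) *s (s x $ i *s \<Theta> i x)) -
        (\<Sum>i\<in>UNIV. if i = j then (x $ q) powi (- (D $ j)) *s \<Theta> j x else 0)"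
      unfolding sum_subtractf[symmetric]
      by (intro sum.cong) (auto simp: \<kappa>_def axis_def vec.scale_left_diff_distrib)
    also have "\<dots> = (form_at l x * (x $ q) powi (- 1)) *s \<rho> x - (x $ q) powi (- (D $ j)) *s \<Theta> j x"
      unfolding \<rho>s[OF x] vec.scale_sum_right by simp
    also have "\<dots> = (form_at l x * ((x $ q) powi (- 1) * (x $ q) powi (1 - D $ j))) *s \<rho>' x
        - (x $ q) powi (- (D $ j)) *s (form_at l x *s \<rho>' x)"
      using \<Theta>\<rho>'[of x] x W(3) by (simp add: \<rho>_def subset_iff mult.assoc)
    also have "(x $ q) powi (- 1) * (x $ q) powi (1 - D $ j) = (x $ q) powi (- (D $ j))"
      using power_int_add[of "x $ q" "- 1" "1 - D $ j"] xq[OF x] by simp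
    finally show ?thesis by (simp add: mult.commute)
  qed
  from syzygy[OF W(1) \<kappa> this W(2)]
  obtain Z g where "v0 \<in> cone Z" "\<And>x. x \<in> cone Z \<Longrightarrow> \<kappa> x = g x *s L x"
    by metis
  then have "\<kappa> v0 $ j = (g v0 *s L v0) $ j" by simp
  then show False
    using xq[OF W(2)] v0 by (simp add: \<kappa>_def)
qed

end

section \<open>Degrees along a line of the arrangement\<close>

context resolution_on_line
begin

text \<open>The determinant of two vectors in the coordinates of the plane over \<open>l\<close>. For a field \<open>\<theta>\<close>
  tangent to \<open>l\<close>, \<open>wedge v (\<theta> v)\<close> measures \<open>\<theta>\<close> modulo the Euler field.\<close>

definition wedge :: "complex ^ 3 \<Rightarrow> complex ^ 3 \<Rightarrow> complex" where
  "wedge v y = linear_form lu v * linear_form lw y - linear_form lw v * linear_form lu y"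

definition meeting_params :: "complex set" where
  "meeting_params = {t. \<exists>H\<in>A - {l}. form_at H (u + t *s w) = 0}"

definition meeting_poly :: "complex poly" where
  "meeting_poly = (\<Prod>t\<in>meeting_params. [:- t, 1:])"

lemma finite_meeting_params: "finite meeting_params"
  unfolding meeting_params_def by (intro finite_line_meets[OF arrangement]) (use general in auto)

lemma card_meeting_params: "card (intersection_points l A) = card meeting_params"
  unfolding meeting_params_def
  by (rule card_intersection_points[OF arrangement l line_basis_axioms general])

lemma degree_meeting_poly: "degree meeting_poly = card meeting_params"
  unfolding meeting_poly_def by (subst degree_prod_eq_sum_degree) auto

lemma meeting_poly_nonzero: "meeting_poly \<noteq> 0"
  unfolding meeting_poly_def using finite_meeting_params by (simp add: prod_zero_iff)

lemma wedge_sum_right: "finite I \<Longrightarrow> wedge v (\<Sum>i\<in>I. c i *s y i) = (\<Sum>i\<in>I. c i * wedge v (y i))"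
  by (induction I rule: finite_induct) (auto simp: wedge_def linear_form_simps algebra_simps)

lemma wedge_constant_field: "wedge v (constant_field A y v) = wedge v y"
  unfolding constant_field_def wedge_def by (simp add: linear_form_simps algebra_simps)

lemma wedge_line_point: "wedge (u + t *s w) y = linear_form lw y - t * linear_form lu y"
  by (simp add: wedge_def linear_form_simps lu lw)

lemma \<Theta>_tangent:
  assumes "v \<noteq> 0" "H \<in> A" "form_at H v = 0"
  shows "form_at H (\<Theta> i v) = 0"
  by (rule annihilating_field_tangent[OF arrangement assms(2), of "- {0}"])
    (use assms \<Theta>_annihilates isCont_regular_punctured[OF \<Theta>_regular] in \<open>auto simp: open_Compl\<close>)

text \<open>At a point where \<open>l\<close> meets another line, a field tangent to both is a multiple of the Euler
  field.\<close>

lemma wedge_\<Theta>_meeting: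
  assumes "t \<in> meeting_params"
  shows "wedge (u + t *s w) (\<Theta> i (u + t *s w)) = 0"
proof -
  obtain H where H: "H \<in> A - {l}" "form_at H (u + t *s w) = 0"
    using assms unfolding meeting_params_def by blast
  define y where "y = \<Theta> i (u + t *s w)"
  have "form_at l y = 0"
    unfolding y_def by (rule \<Theta>_tangent[OF line_point_nonzero l form_line_point])
  from expand[OF this] have "form_at H y = linear_form lu y * form_at H u + linear_form lw y * form_at H w"
    by (metis linear_form_add linear_form_scale)
  moreover have "form_at H y = 0"
    unfolding y_def using H by (intro \<Theta>_tangent line_point_nonzero) auto
  moreover have "form_at H u = - t * form_at H w"
    using H(2) by (simp add: linear_form_simps eq_neg_iff_add_eq_0)
  ultimately have "(linear_form lw y - t * linear_form lu y) * form_at H w = 0"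
    by (auto simp: algebra_simps)
  then show ?thesis
    using general[OF H(1)] unfolding y_def[symmetric] wedge_line_point by simp
qed

lemma regular_wedge: "regular (D $ i + 1) (- {0}) (\<lambda>v. wedge v (\<Theta> i v))"
proof -
  have "regular (1 + D $ i) (- {0}) (\<lambda>v. linear_form a v * linear_form b (\<Theta> i v))" for a b
    using regular_mult[OF regular_hom_poly[OF hom_poly_linear_form] regular_linear_form[OF _ \<Theta>_regular]]
    by simp
  then show ?thesis
    unfolding wedge_def by (intro regular_diff) (simp_all add: add.commute)
qed

text \<open>On \<open>l\<close> the wedge is a form of degree \<open>D $ i + 1\<close> vanishing at the \<open>h\<close> intersection points. The
  cofactor \<open>q\<close> is a form of degree \<open>D $ i + 1 - h\<close> written in an affine parameter, so its degree as a
  polynomial drops exactly when the form vanishes at infinity.\<close>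

lemma exists_reduced_wedge:
  obtains q where "\<And>t. wedge (u + t *s w) (\<Theta> i (u + t *s w)) = poly (meeting_poly * q) t"
    "q \<noteq> 0 \<Longrightarrow> int (degree q) + int (card meeting_params) \<le> D $ i + 1"
    "wedge w (\<Theta> i w) \<noteq> 0 \<Longrightarrow> int (degree q) + int (card meeting_params) = D $ i + 1"
proof -
  obtain p where p: "\<And>t. wedge (u + t *s w) (\<Theta> i (u + t *s w)) = poly p t"
    and deg: "p \<noteq> 0 \<Longrightarrow> int (degree p) \<le> D $ i + 1"
    and inf: "wedge w (\<Theta> i w) = (if D $ i + 1 \<ge> 0 then coeff p (nat (D $ i + 1)) else 0)"
    using regular_on_line_poly[OF regular_wedge[of i] coordinates_independent] by metis
  have "meeting_poly dvd p"
    unfolding meeting_poly_def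
    using wedge_\<Theta>_meeting p by (intro prod_linear_factors_dvd finite_meeting_params) metis
  then obtain q where q: "p = meeting_poly * q" by (rule dvdE)
  have degq: "degree p = degree q + card meeting_params" if "q \<noteq> 0"
    unfolding q using that meeting_poly_nonzero by (simp add: degree_mult_eq degree_meeting_poly)
  show thesis
  proof (rule that[of q])
    show "wedge (u + t *s w) (\<Theta> i (u + t *s w)) = poly (meeting_poly * q) t" for t
      using p q by simp
    show "int (degree q) + int (card meeting_params) \<le> D $ i + 1" if "q \<noteq> 0"
      using deg degq[OF that] that meeting_poly_nonzero q by auto
    show "int (degree q) + int (card meeting_params) = D $ i + 1" if "wedge w (\<Theta> i w) \<noteq> 0"
    proof -
      have *: "D $ i + 1 \<ge> 0" "coeff p (nat (D $ i + 1)) \<noteq> 0"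
        using that inf by (auto split: if_splits)
      then have "nat (D $ i + 1) \<le> degree p" "p \<noteq> 0" by (auto intro: le_degree)
      moreover from \<open>p \<noteq> 0\<close> have "q \<noteq> 0" using q by auto
      ultimately show ?thesis using deg degq * by simp
    qed
  qed
qed

lemma constant_field_in_generators:
  assumes v: "v \<noteq> 0" "\<forall>K\<in>A. form_at K y \<noteq> 0 \<longrightarrow> form_at K v \<noteq> 0"
  shows "\<exists>V s. open V \<and> v \<in> V \<and> (\<forall>i. regular (- (D $ i)) V (\<lambda>x. s x $ i)) \<and>
    (\<forall>x\<in>V. wedge x y = (\<Sum>i\<in>UNIV. s x $ i * wedge x (\<Theta> i x)))"
proof -
  have "A \<noteq> {}" using l by blast
  obtain U where U: "zariski_open U" "cone U = {x. x \<noteq> 0 \<and> (\<forall>K\<in>A. form_at K y \<noteq> 0 \<longrightarrow> form_at K x \<noteq> 0)}"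
    and sec: "restr U (constant_field A y) \<in> arrangement_bundle A U"
    using constant_field_section[OF arrangement \<open>A \<noteq> {}\<close>] by blast
  have "v \<in> cone U" unfolding U(2) using v by blast
  from generates[OF U(1) sec this]
  obtain V s where V: "zariski_open V" "v \<in> cone V" "cone V \<subseteq> cone U"
    and s: "\<And>i. regular (- (D $ i)) (cone V) (\<lambda>x. s x $ i)"
    and eq: "\<And>x. x \<in> cone V \<Longrightarrow> restr U (constant_field A y) x = (\<Sum>i\<in>UNIV. s x $ i *s \<Theta> i x)"
    by (elim exE conjE) (rule that; blast)
  have "wedge x y = (\<Sum>i\<in>UNIV. s x $ i * wedge x (\<Theta> i x))" if "x \<in> cone V" for x
  proof -
    have "constant_field A y x = (\<Sum>i\<in>UNIV. s x $ i *s \<Theta> i x)"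
      using eq[OF that] V(3) that by (auto simp: restr_def)
    then show ?thesis
      using wedge_constant_field[of x y] by (simp add: wedge_sum_right)
  qed
  then show ?thesis
    using open_cone[OF V(1)] V(2) s by (intro exI[of _ "cone V"] exI[of _ s]) simp
qed

text \<open>In terms of sheaves, the bundle surjects onto \<open>\<O>\<^sub>l(1 - h)\<close>. At a point of \<open>l\<close> on no other line,
  the corrected constant field in the direction of another vector of \<open>l\<close> is regular and has nonzero
  wedge. At an intersection point, the corrected constant field of the point itself is regular and
  its wedge has a simple zero, which is the zero of \<open>meeting_poly\<close>. Either field is a combination of
  the generators, so their cofactors cannot all vanish.\<close>

lemma reduced_wedges_no_common_zero:
  assumes q: "\<And>i t. wedge (u + t *s w) (\<Theta> i (u + t *s w)) = poly (meeting_poly * q i) t"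
  shows "\<exists>i. poly (q i) a \<noteq> 0"
proof (rule ccontr)
  assume "\<not> ?thesis"
  then have zero: "poly (q i) a = 0" for i by blast
  define y where "y = (if a \<in> meeting_params then u + a *s w else w)"
  have "\<forall>K\<in>A. form_at K y \<noteq> 0 \<longrightarrow> form_at K (u + a *s w) \<noteq> 0"
    using form_w unfolding y_def meeting_params_def by (auto split: if_splits)
  from constant_field_in_generators[OF line_point_nonzero this]
  obtain V s where V: "open V" "u + a *s w \<in> V"
    and "\<forall>i. regular (- (D $ i)) V (\<lambda>x. s x $ i)"
    and "\<forall>x\<in>V. wedge x y = (\<Sum>i\<in>UNIV. s x $ i * wedge x (\<Theta> i x))"
    by (elim exE conjE) (rule that)
  then have s: "\<And>i. regular (- (D $ i)) V (\<lambda>x. s x $ i)"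
    and eq: "\<And>x. x \<in> V \<Longrightarrow> wedge x y = (\<Sum>i\<in>UNIV. s x $ i * wedge x (\<Theta> i x))"
    by simp_all
  show False
  proof (cases "a \<in> meeting_params")
    case False
    then have "wedge (u + a *s w) y = 1"
      by (simp add: y_def wedge_line_point lu lw)
    then show False using eq[OF V(2)] by (simp add: q zero)
  next
    case True
    define r where "r = (\<Prod>t\<in>meeting_params - {a}. [:- t, 1:])"
    have mp: "meeting_poly = [:- a, 1:] * r"
      unfolding meeting_poly_def r_def using finite_meeting_params True by (rule prod.remove)
    have "open ((\<lambda>t. u + t *s w) -` V)"
      by (intro continuous_open_vimage V isCont_affine_line)
    moreover have "a \<in> (\<lambda>t. u + t *s w) -` V" using V by simp
    ultimately have "\<forall>\<^sub>F t in at a. t \<in> (\<lambda>t. u + t *s w) -` V"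
      by (rule eventually_at_in_open')
    moreover have "\<forall>\<^sub>F t in at a. t \<noteq> a"
      by (simp add: eventually_at_filter)
    ultimately have "\<forall>\<^sub>F t in at a. - 1 = (\<Sum>i\<in>UNIV. s (u + t *s w) $ i * (poly r t * poly (q i) t))"
    proof eventually_elim
      case (elim t)
      have "a - t = wedge (u + t *s w) y"
        using True by (simp add: y_def wedge_line_point linear_form_simps lu lw)
      also have "\<dots> = (\<Sum>i\<in>UNIV. s (u + t *s w) $ i * ((t - a) * (poly r t * poly (q i) t)))"
        using eq[of "u + t *s w"] elim(1) by (simp add: q mp algebra_simps)
      also have "\<dots> = (t - a) * (\<Sum>i\<in>UNIV. s (u + t *s w) $ i * (poly r t * poly (q i) t))"
        by (simp only: sum_distrib_left mult_ac)
      finally have "(t - a) * (- 1) = (t - a) * (\<Sum>i\<in>UNIV. s (u + t *s w) $ i * (poly r t * poly (q i) t))"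
        by simp
      then show ?case using elim(2) by (simp only: mult_cancel_left) simp
    qed
    moreover have "isCont (\<lambda>t. \<Sum>i\<in>UNIV. s (u + t *s w) $ i * (poly r t * poly (q i) t)) a"
      by (intro continuous_sum continuous_mult isCont_regular_on_line[OF s V] poly_isCont)
    ultimately have "- 1 = (\<Sum>i\<in>UNIV. s (u + a *s w) $ i * (poly r a * poly (q i) a))"
      using isCont_eq_limit[of a "\<lambda>_. - 1" "\<lambda>t. \<Sum>i\<in>UNIV. s (u + t *s w) $ i * (poly r t * poly (q i) t)"]
      by simp
    then show False by (simp add: zero)
  qed
qed

lemma wedge_at_infinity: "\<exists>i. wedge w (\<Theta> i w) \<noteq> 0"
proof (rule ccontr)
  assume "\<not> ?thesis"
  then have zero: "wedge w (\<Theta> i w) = 0" for i by blast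
  have "\<forall>K\<in>A. form_at K u \<noteq> 0 \<longrightarrow> form_at K w \<noteq> 0"
    using general form_u by auto
  from constant_field_in_generators[OF w_nonzero this]
  obtain V s where "w \<in> V" "\<forall>x\<in>V. wedge x u = (\<Sum>i\<in>UNIV. (s x :: complex ^ 3) $ i * wedge x (\<Theta> i x))"
    by (elim exE conjE) (rule that)
  then have "wedge w u = 0" using zero by simp
  then show False by (simp add: wedge_def lu lw)
qed

end

text \<open>Below, \<open>q i\<close> is the cofactor of the wedge of \<open>\<Theta> i\<close> on \<open>l\<close> and \<open>p i\<close> the restriction of \<open>L $ i\<close>.\<close>

theorem proposition2p5:
  fixes A :: "point set set" and l :: "point set" and a b d :: int and h :: nat
  assumes "arrangement A"
    and "plus_one_generated A a b d"
    and "l \<in> A"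
    and "h = card (intersection_points l A)"
  shows "int h < a \<or> int h = a \<or> int h = a + 1 \<or> int h = b \<or> int h = b + 1 \<or> int h = d + 1"
proof (rule ccontr)
  assume neg: "\<not> ?thesis"
  have ab: "a \<le> b" "b \<le> d" using assms(2) unfolding plus_one_generated_def by auto
  define D where "D = (vector [d, b, a] :: int ^ 3)"
  obtain L \<Theta> where res: "plus_one_resolution A D (- 1 - d) L \<Theta>"
    using plus_one_generated_resolution[OF assms(1,2)] unfolding D_def .
  have D: "D $ 1 = d" "D $ 2 = b" "D $ 3 = a" by (simp_all add: D_def)
  obtain w where w: "w \<noteq> 0" "form_at l w = 0" "\<And>H. H \<in> A - {l} \<Longrightarrow> form_at H w \<noteq> 0"
    by (rule exists_general_vector[OF assms(1,3)]) (rule that; blast)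
  obtain u lu lw where lb: "line_basis (form_of l) u w lu lw"
    using exists_line_basis[OF form_of(1)[OF assms(1,3)] w(1,2)] .
  interpret resolution_on_line A D "- 1 - d" L \<Theta> l u w lu lw
    by (intro resolution_on_line.intro resolution_on_line_axioms.intro res lb assms(3) w(3))
  have h: "h = card meeting_params" using assms(4) card_meeting_params by simp
  have "\<exists>q. (\<forall>t. wedge (u + t *s w) (\<Theta> i (u + t *s w)) = poly (meeting_poly * q) t) \<and>
      (q \<noteq> 0 \<longrightarrow> int (degree q) + int h \<le> D $ i + 1) \<and>
      (wedge w (\<Theta> i w) \<noteq> 0 \<longrightarrow> int (degree q) + int h = D $ i + 1)" for i
    by (rule exists_reduced_wedge[of i]) (auto simp: h)
  then obtain q where q: "\<And>i t. wedge (u + t *s w) (\<Theta> i (u + t *s w)) = poly (meeting_poly * q i) t"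
    and deg: "\<And>i. q i \<noteq> 0 \<Longrightarrow> int (degree (q i)) + int h \<le> D $ i + 1"
    and inf: "\<And>i. wedge w (\<Theta> i w) \<noteq> 0 \<Longrightarrow> int (degree (q i)) + int h = D $ i + 1"
    by metis
  note no_zero = reduced_wedges_no_common_zero[OF q]
  have wedge0: "wedge w (\<Theta> i w) = 0" if "q i = 0" for i
  proof (rule ccontr)
    assume nz: "wedge w (\<Theta> i w) \<noteq> 0"
    have "regular (D $ i + 1) (- {0}) (\<lambda>v. wedge v (\<Theta> i v))" by (rule regular_wedge)
    from zero_on_line[OF this _ w(1,2)] nz q[of _ i] that show False by simp
  qed
  have q3: "q 3 = 0"
    using deg[of 3] neg D by fastforce
  have q2: "q 2 \<noteq> 0"
  proof
    assume q2: "q 2 = 0"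
    have "poly (q 1) t \<noteq> 0" for t
      using no_zero[of t] q2 q3 exhaust_3 by (metis poly_0)
    then have "degree (q 1) = 0"
      using alg_closed_imp_poly_has_root[of "q 1"] by blast
    moreover have "wedge w (\<Theta> 1 w) \<noteq> 0"
      using wedge_at_infinity wedge0[OF q2] wedge0[OF q3] exhaust_3 by metis
    ultimately show False using inf[of 1] neg D by simp
  qed
  then have hb: "int h < b" using deg[of 2] neg D by auto
  have "\<exists>p. (\<forall>t. L (u + t *s w) $ i = poly p t) \<and> (p \<noteq> 0 \<longrightarrow> int (degree p) \<le> - (D $ i) - (- 1 - d))" for i
    by (rule regular_on_line_poly[OF L_regular[of i] coordinates_independent]) auto
  then obtain p where p: "\<And>i t. L (u + t *s w) $ i = poly (p i) t"
    and degp: "\<And>i. p i \<noteq> 0 \<Longrightarrow> int (degree (p i)) \<le> - (D $ i) - (- 1 - d)"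
    by metis
  have rel: "p 1 * q 1 + p 2 * q 2 = 0"
  proof -
    have "poly (meeting_poly * (p 1 * q 1 + p 2 * q 2)) t = 0" for t
    proof -
      let ?x = "u + t *s w"
      have "0 = wedge ?x (\<Sum>i\<in>UNIV. L ?x $ i *s \<Theta> i ?x)"
        using relation[OF line_point_nonzero[of t]] by (simp add: wedge_def linear_form_zero)
      also have "\<dots> = (\<Sum>i\<in>UNIV. poly (p i) t * poly (meeting_poly * q i) t)"
        by (simp add: wedge_sum_right q p)
      also have "\<dots> = poly (meeting_poly * (p 1 * q 1 + p 2 * q 2)) t"
        by (simp add: sum_3 q3 algebra_simps)
      finally show ?thesis by simp
    qed
    then have "meeting_poly * (p 1 * q 1 + p 2 * q 2) = 0" using poly_all_0_iff_0[of "meeting_poly * (p 1 * q 1 + p 2 * q 2)"] by blast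
    then show ?thesis using meeting_poly_nonzero by simp
  qed
  have p1: "p 1 = 0"
  proof (rule ccontr)
    assume p1: "p 1 \<noteq> 0"
    have "p 1 * q 1 = q 2 * (- p 2)" using rel by (simp add: eq_neg_iff_add_eq_0 mult.commute)
    then have "q 2 dvd p 1 * q 1" by simp
    moreover have "poly (q 1) z \<noteq> 0" if "poly (q 2) z = 0" for z
      using no_zero[of z] that q3 exhaust_3 by (metis poly_0)
    ultimately have "q 2 dvd p 1"
      using dvd_mult_no_common_root[OF q2] by blast
    then have dq2: "degree (q 2) \<le> degree (p 1)" by (rule dvd_imp_degree_le[OF _ p1])
    \<comment> \<open>The form of \<open>q 2\<close> has degree \<open>b + 1 - h \<ge> 2\<close> but \<open>q 2\<close> has degree at most \<open>1\<close>, so it vanishes at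
      infinity. Then \<open>q 1\<close> does not, and its degree is known exactly.\<close>
    then have "wedge w (\<Theta> 2 w) = 0"
      using inf[of 2] degp[OF p1] hb D by fastforce
    then have "wedge w (\<Theta> 1 w) \<noteq> 0"
      using wedge_at_infinity wedge0[OF q3] exhaust_3 by metis
    then have q1: "q 1 \<noteq> 0" "int (degree (q 1)) + int h = d + 1"
      using wedge0 inf[of 1] D by auto
    have eq: "p 1 * q 1 = - (p 2 * q 2)" using rel by (simp add: eq_neg_iff_add_eq_0)
    then have p2: "p 2 \<noteq> 0" using p1 q1 by auto
    have "degree (p 1) + degree (q 1) = degree (p 2) + degree (q 2)"
      using arg_cong[OF eq, of degree] p1 p2 q1 q2 by (simp add: degree_mult_eq)
    then show False using degp[OF p2] dq2 q1(2) hb D by simp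
  qed
  have p2: "p 2 = 0" using rel p1 q2 by simp
  have "L v $ i = 0" if "i \<noteq> 3" "v \<noteq> 0" "form_at l v = 0" for i v
  proof (rule zero_on_line[OF L_regular _ that(2,3)])
    show "L (u + t *s w) $ i = 0" for t
      using p[where i = i] that(1) p1 p2 exhaust_3[of i] by auto
  qed
  then show False
    using relation_not_concentrated_on_line[of 3] D ab by auto
qed

end
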